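(* Let $(M,g)$ be any Riemannian manifold of dimension $d\ge2$, and let $\Delta f=\operatorname{tr}\nabla^2_{*,*}f$ denote its Laplacian. For $\beta_0=0,1,2,\dots$ define nonlinear differential operators $P^{\beta_0},Q^{\beta_0}$ on $M$ by $$P^{\beta_0}f=f^{\beta_0}\cdot\Big(\|\nabla f\|^2(\Delta f)^2-\|\nabla f\|^2\|\nabla^2f\|^2+2\|\nabla^2f(\nabla f,\cdot)\|^2-2\,\Delta f\cdot\nabla^2f(\nabla f,\nabla f)\Big),$$ $$Q^{\beta_0}f=f^{\beta_0}\cdot\Big((\Delta f)^3-3\,\Delta f\,\|\nabla^2f\|^2+2\operatorname{tr}\nabla^2_{*_1,*_2}f\,\nabla^2_{*_1,*_3}f\,\nabla^2_{*_2,*_3}f\Big),$$ for $f\in C^\infty(M)$. Then these operators are equivariant with respect to isometries, i.e. $P^{\beta_0}(f\circ\varphi)=(P^{\beta_0}f)\circ\varphi$ and $Q^{\beta_0}(f\circ\varphi)=(Q^{\beta_0}f)\circ\varphi$ for every isometry $\varphi$ of $(M,g)$, every $f\in C^\infty(M)$ and every $\beta_0\ge 0$. Furthermore, for each $\beta_0\geq 0$, each of the operators $P^{\beta_0}$, $Q^{\beta_0}$ is identically zero (vanishes on all $f\in C^\infty(M)$) if and only if $d=2$.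
   Context: $\nabla$ is the Levi-Civita connection and $\nabla^2f$ is the Hessian, a symmetric covariant $2$-tensor: $\nabla^2_{X,Y}f=XYf-(\nabla_XY)f$. As an argument, $\nabla f$ denotes the gradient vector field. Norms are those induced by $g$ on vectors and covariant tensors. $\nabla^2 f(\nabla f,\cdot)$ is the one-form $Y\mapsto\nabla^2f(\nabla f,Y)$. The symbol $\operatorname{tr}$ with labels $*_i$ means metric trace over slots with equal labels; so in a local orthonormal frame $e_1,\dots,e_d$, with $A_{ij}=\nabla^2f(e_i,e_j)$, one has $\Delta f=\sum_iA_{ii}$, $\|\nabla^2 f\|^2=\sum_{i,j}A_{ij}^2$ and $\operatorname{tr}\nabla^2_{*_1,*_2}f\,\nabla^2_{*_1,*_3}f\,\nabla^2_{*_2,*_3}f=\sum_{i,j,k}A_{ij}A_{ik}A_{jk}$. Functions are real valued and $f^0=1$. *)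

theory Defs
  imports "HOL-Analysis.Analysis"
begin

section \<open>Smooth functions between open subsets of normed spaces\<close>

text \<open>Intended for open \<open>S\<close>: all iterated directional derivatives up to order \<open>k\<close> exist and
  are continuous.\<close>

primrec k_smooth_on ::
  "'a::real_normed_vector set \<Rightarrow> nat \<Rightarrow> ('a \<Rightarrow> 'b::real_normed_vector) \<Rightarrow> bool" where
  "k_smooth_on S 0 f \<longleftrightarrow> continuous_on S f"
| "k_smooth_on S (Suc k) f \<longleftrightarrow>
     (\<forall>x\<in>S. f differentiable (at x)) \<and>
     (\<forall>v. k_smooth_on S k (\<lambda>x. frechet_derivative f (at x) v))"

definition smooth_on ::
  "'a::real_normed_vector set \<Rightarrow> ('a \<Rightarrow> 'b::real_normed_vector) \<Rightarrow> bool" where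
  "smooth_on S f \<longleftrightarrow> (\<forall>k. k_smooth_on S k f)"


section \<open>Smooth manifolds\<close>

text \<open>The points of the manifold are the elements of a type \<open>'m\<close>, whose topology is Hausdorff and
  second countable in the theorem; the dimension is \<open>CARD('n)\<close>. The smooth structure is given by
  an arbitrary smooth atlas, not necessarily a maximal one.\<close>

type_synonym ('m, 'n) chart = "'m set \<times> ('m \<Rightarrow> real^'n)"

definition is_chart :: "('m::topological_space, 'n::finite) chart \<Rightarrow> bool" where
  "is_chart c \<longleftrightarrow> (case c of (U, x) \<Rightarrow>
     open U \<and> open (x ` U) \<and> homeomorphism U (x ` U) x (inv_into U x))"

definition smooth_atlas :: "('m::topological_space, 'n::finite) chart set \<Rightarrow> bool" where
  "smooth_atlas A \<longleftrightarrow>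
     (\<forall>c\<in>A. is_chart c) \<and>
     (\<Union>c\<in>A. fst c) = UNIV \<and>
     (\<forall>(U, x)\<in>A. \<forall>(V, y)\<in>A. smooth_on (x ` (U \<inter> V)) (y \<circ> inv_into U x))"

definition smooth_functions ::
  "('m::topological_space, 'n::finite) chart set \<Rightarrow> ('m \<Rightarrow> real) set" where
  "smooth_functions A = {f. \<forall>(U, x)\<in>A. smooth_on (x ` U) (f \<circ> inv_into U x)}"

definition smooth_map ::
  "('m::topological_space, 'n::finite) chart set \<Rightarrow> ('m \<Rightarrow> 'm) \<Rightarrow> bool" where
  "smooth_map A \<phi> \<longleftrightarrow> continuous_on UNIV \<phi> \<and>
     (\<forall>(U, x)\<in>A. \<forall>(V, y)\<in>A. smooth_on (x ` (U \<inter> \<phi> -` V)) (y \<circ> \<phi> \<circ> inv_into U x))"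

definition diffeomorphism ::
  "('m::topological_space, 'n::finite) chart set \<Rightarrow> ('m \<Rightarrow> 'm) \<Rightarrow> bool" where
  "diffeomorphism A \<phi> \<longleftrightarrow> bij \<phi> \<and> smooth_map A \<phi> \<and> smooth_map A (inv \<phi>)"


section \<open>Tangent vectors and vector fields\<close>

text \<open>A tangent vector at \<open>p\<close> is the operator on \<open>C\<^sup>\<infinity>(M)\<close> that differentiates at \<open>p\<close> in some
  coordinate direction \<open>a\<close>. Operators are extended by zero to functions that are not smooth, so
  that equality of tangent vectors is equality of their values on \<open>C\<^sup>\<infinity>(M)\<close>.\<close>

type_synonym 'm tangent = "('m \<Rightarrow> real) \<Rightarrow> real"

definition coord_vector ::
  "('m::topological_space, 'n::finite) chart set \<Rightarrow> ('m, 'n) chart \<Rightarrow> 'm \<Rightarrow> real^'n \<Rightarrow> 'm tangent"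
  where
  "coord_vector A c p a = (case c of (U, x) \<Rightarrow>
     (\<lambda>f. if f \<in> smooth_functions A
          then frechet_derivative (f \<circ> inv_into U x) (at (x p)) a else 0))"

definition tangent_space ::
  "('m::topological_space, 'n::finite) chart set \<Rightarrow> 'm \<Rightarrow> 'm tangent set" where
  "tangent_space A p = {coord_vector A c p a | c a. c \<in> A \<and> p \<in> fst c}"

definition push_forward :: "('m \<Rightarrow> 'm) \<Rightarrow> 'm tangent \<Rightarrow> 'm tangent" where
  "push_forward \<phi> u = (\<lambda>f. u (f \<circ> \<phi>))"

type_synonym 'm vector_field = "'m \<Rightarrow> 'm tangent"

definition vector_fields ::
  "('m::topological_space, 'n::finite) chart set \<Rightarrow> 'm vector_field set" where
  "vector_fields A = {X. (\<forall>p. X p \<in> tangent_space A p) \<and>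
     (\<forall>f\<in>smooth_functions A. (\<lambda>p. X p f) \<in> smooth_functions A)}"

definition vf_add :: "'m vector_field \<Rightarrow> 'm vector_field \<Rightarrow> 'm vector_field" where
  "vf_add X Y = (\<lambda>p f. X p f + Y p f)"

definition vf_scale :: "('m \<Rightarrow> real) \<Rightarrow> 'm vector_field \<Rightarrow> 'm vector_field" where
  "vf_scale h X = (\<lambda>p f. h p * X p f)"

definition lie_bracket :: "'m vector_field \<Rightarrow> 'm vector_field \<Rightarrow> 'm vector_field" where
  "lie_bracket X Y = (\<lambda>p f. X p (\<lambda>q. Y q f) - Y p (\<lambda>q. X q f))"


section \<open>Riemannian metrics, isometries and the Levi-Civita connection\<close>

type_synonym 'm metric = "'m \<Rightarrow> 'm tangent \<Rightarrow> 'm tangent \<Rightarrow> real"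

definition riemannian_metric ::
  "('m::topological_space, 'n::finite) chart set \<Rightarrow> 'm metric \<Rightarrow> bool" where
  "riemannian_metric A g \<longleftrightarrow>
     (\<forall>p. \<forall>u\<in>tangent_space A p. \<forall>v\<in>tangent_space A p. g p u v = g p v u) \<and>
     (\<forall>p. \<forall>u\<in>tangent_space A p. \<forall>v\<in>tangent_space A p. \<forall>w\<in>tangent_space A p. \<forall>a b.
        g p (\<lambda>f. a * u f + b * v f) w = a * g p u w + b * g p v w) \<and>
     (\<forall>p. \<forall>u\<in>tangent_space A p. u \<noteq> (\<lambda>f. 0) \<longrightarrow> g p u u > 0) \<and>
     (\<forall>X\<in>vector_fields A. \<forall>Y\<in>vector_fields A. (\<lambda>p. g p (X p) (Y p)) \<in> smooth_functions A)"

definition riemannian_manifold ::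
  "('m::topological_space, 'n::finite) chart set \<Rightarrow> 'm metric \<Rightarrow> bool" where
  "riemannian_manifold A g \<longleftrightarrow> smooth_atlas A \<and> riemannian_metric A g"

definition isometry ::
  "('m::topological_space, 'n::finite) chart set \<Rightarrow> 'm metric \<Rightarrow> ('m \<Rightarrow> 'm) \<Rightarrow> bool" where
  "isometry A g \<phi> \<longleftrightarrow> diffeomorphism A \<phi> \<and>
     (\<forall>p. \<forall>u\<in>tangent_space A p. \<forall>v\<in>tangent_space A p.
        g (\<phi> p) (push_forward \<phi> u) (push_forward \<phi> v) = g p u v)"

type_synonym 'm connection = "'m vector_field \<Rightarrow> 'm vector_field \<Rightarrow> 'm vector_field"

definition affine_connection ::
  "('m::topological_space, 'n::finite) chart set \<Rightarrow> 'm connection \<Rightarrow> bool" where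
  "affine_connection A D \<longleftrightarrow>
     (\<forall>X\<in>vector_fields A. \<forall>Y\<in>vector_fields A. D X Y \<in> vector_fields A) \<and>
     (\<forall>X\<in>vector_fields A. \<forall>Y\<in>vector_fields A. \<forall>Z\<in>vector_fields A.
        D (vf_add X Y) Z = vf_add (D X Z) (D Y Z) \<and>
        D X (vf_add Y Z) = vf_add (D X Y) (D X Z)) \<and>
     (\<forall>h\<in>smooth_functions A. \<forall>X\<in>vector_fields A. \<forall>Y\<in>vector_fields A.
        D (vf_scale h X) Y = vf_scale h (D X Y) \<and>
        D X (vf_scale h Y) = vf_add (vf_scale (\<lambda>p. X p h) Y) (vf_scale h (D X Y)))"

text \<open>Only the values of \<open>D\<close> on smooth vector fields are constrained (and used); there the
  conditions determine \<open>D\<close> uniquely.\<close>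

definition levi_civita ::
  "('m::topological_space, 'n::finite) chart set \<Rightarrow> 'm metric \<Rightarrow> 'm connection \<Rightarrow> bool" where
  "levi_civita A g D \<longleftrightarrow> affine_connection A D \<and>
     (\<forall>X\<in>vector_fields A. \<forall>Y\<in>vector_fields A.
        (\<lambda>p f. D X Y p f - D Y X p f) = lie_bracket X Y) \<and>
     (\<forall>X\<in>vector_fields A. \<forall>Y\<in>vector_fields A. \<forall>Z\<in>vector_fields A. \<forall>p.
        X p (\<lambda>q. g q (Y q) (Z q)) = g p (D X Y p) (Z p) + g p (Y p) (D X Z p))"


section \<open>Gradient, Hessian, metric traces and norms\<close>

definition gradient ::
  "('m::topological_space, 'n::finite) chart set \<Rightarrow> 'm metric \<Rightarrow> ('m \<Rightarrow> real) \<Rightarrow> 'm vector_field"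
  where
  "gradient A g f p =
     (THE v. v \<in> tangent_space A p \<and> (\<forall>u\<in>tangent_space A p. g p v u = u f))"

text \<open>The Hessian is tensorial, so its value on tangent vectors \<open>u\<close>, \<open>v\<close> at \<open>p\<close> is the common value
  of \<open>X Y f - (\<nabla>\<^sub>X Y) f\<close> at \<open>p\<close> for all smooth vector fields \<open>X\<close>, \<open>Y\<close> extending \<open>u\<close>, \<open>v\<close>.\<close>

definition hessian ::
  "('m::topological_space, 'n::finite) chart set \<Rightarrow> 'm connection \<Rightarrow> ('m \<Rightarrow> real) \<Rightarrow>
     'm \<Rightarrow> 'm tangent \<Rightarrow> 'm tangent \<Rightarrow> real" where
  "hessian A D f p u v =
     (THE h. \<forall>X\<in>vector_fields A. \<forall>Y\<in>vector_fields A. X p = u \<and> Y p = v \<longrightarrow>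
        h = X p (\<lambda>q. Y q f) - D X Y p f)"

definition orthonormal_basis ::
  "('m::topological_space, 'n::finite) chart set \<Rightarrow> 'm metric \<Rightarrow> 'm \<Rightarrow> ('n \<Rightarrow> 'm tangent) \<Rightarrow> bool"
  where
  "orthonormal_basis A g p e \<longleftrightarrow>
     (\<forall>i. e i \<in> tangent_space A p) \<and> (\<forall>i j. g p (e i) (e j) = (if i = j then 1 else 0))"

text \<open>For bilinear \<open>B\<close> the value does not depend on the orthonormal basis chosen. Below, the two
  arguments of \<open>B\<close> are the slots carrying a common label; several labels give nested traces.\<close>

definition metric_trace ::
  "('m::topological_space, 'n::finite) chart set \<Rightarrow> 'm metric \<Rightarrow> 'm \<Rightarrow>
     ('m tangent \<Rightarrow> 'm tangent \<Rightarrow> real) \<Rightarrow> real" where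
  "metric_trace A g p B =
     (let e = (SOME e. orthonormal_basis A g p e) in \<Sum>i\<in>UNIV. B (e i) (e i))"

definition vector_norm :: "'m metric \<Rightarrow> 'm \<Rightarrow> 'm tangent \<Rightarrow> real" where
  "vector_norm g p v = sqrt (g p v v)"

definition covector_norm ::
  "('m::topological_space, 'n::finite) chart set \<Rightarrow> 'm metric \<Rightarrow> 'm \<Rightarrow> ('m tangent \<Rightarrow> real) \<Rightarrow> real"
  where
  "covector_norm A g p \<alpha> = sqrt (metric_trace A g p (\<lambda>u u'. \<alpha> u * \<alpha> u'))"

definition tensor2_norm ::
  "('m::topological_space, 'n::finite) chart set \<Rightarrow> 'm metric \<Rightarrow> 'm \<Rightarrow>
     ('m tangent \<Rightarrow> 'm tangent \<Rightarrow> real) \<Rightarrow> real" where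
  "tensor2_norm A g p T =
     sqrt (metric_trace A g p (\<lambda>u u'. metric_trace A g p (\<lambda>v v'. T u v * T u' v')))"

definition laplacian ::
  "('m::topological_space, 'n::finite) chart set \<Rightarrow> 'm metric \<Rightarrow> 'm connection \<Rightarrow>
     ('m \<Rightarrow> real) \<Rightarrow> 'm \<Rightarrow> real" where
  "laplacian A g D f p = metric_trace A g p (hessian A D f p)"


section \<open>The operators\<close>

definition P_op ::
  "('m::topological_space, 'n::finite) chart set \<Rightarrow> 'm metric \<Rightarrow> 'm connection \<Rightarrow> nat \<Rightarrow>
     ('m \<Rightarrow> real) \<Rightarrow> 'm \<Rightarrow> real" where
  "P_op A g D \<beta> f p =
    (let G = gradient A g f p; H = hessian A D f p; L = laplacian A g D f p in
     f p ^ \<beta> *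
       ((vector_norm g p G)\<^sup>2 * L\<^sup>2
        - (vector_norm g p G)\<^sup>2 * (tensor2_norm A g p H)\<^sup>2
        + 2 * (covector_norm A g p (\<lambda>v. H G v))\<^sup>2
        - 2 * L * H G G))"

definition Q_op ::
  "('m::topological_space, 'n::finite) chart set \<Rightarrow> 'm metric \<Rightarrow> 'm connection \<Rightarrow> nat \<Rightarrow>
     ('m \<Rightarrow> real) \<Rightarrow> 'm \<Rightarrow> real" where
  "Q_op A g D \<beta> f p =
    (let H = hessian A D f p; L = laplacian A g D f p in
     f p ^ \<beta> *
       (L ^ 3
        - 3 * L * (tensor2_norm A g p H)\<^sup>2
        + 2 * metric_trace A g p (\<lambda>u u'. metric_trace A g p (\<lambda>v v'. metric_trace A g p (\<lambda>w w'.
                H u v * H u' w * H v' w')))))"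

end

theory Submission
  imports Defs
begin

text \<open>
  Let \<open>G\<close> and \<open>H\<close> be the components of the gradient and the Hessian of \<open>f\<close> at a point in an orthonormal
  basis. Then \<open>P f\<close> and \<open>Q f\<close> are \<open>f\<^sup>\<beta>\<close> times polynomials in \<open>G\<close> and \<open>H\<close> that are the same for all
  orthonormal bases (\<open>P_op_frame\<close>, \<open>Q_op_frame\<close>), because the metric trace of a bilinear form does not
  depend on the basis. All statements are read off from this.

  Equivariance: an isometry \<open>\<phi>\<close> maps orthonormal bases to orthonormal bases, and the gradient and the
  Hessian of \<open>f \<circ> \<phi>\<close> are those of \<open>f\<close> transported along \<open>\<phi>\<close>. For the Hessian this needs
  \<open>D (\<phi>\<^sub>* X) (\<phi>\<^sub>* Y) = \<phi>\<^sub>* (D X Y)\<close>, which holds since a torsion free metric connection is unique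
  (\<open>levi_civita_unique\<close>, \<open>isometry_connection\<close>).

  Vanishing: let \<open>l\<close> be the eigenvalues of \<open>H\<close> and \<open>e\<^sub>k\<close> the elementary symmetric polynomials. In a
  basis of eigenvectors the two polynomials are \<open>2 \<Sum>i. (G i)\<^sup>2 e\<^sub>2(l without l i)\<close> and \<open>6 e\<^sub>3(l)\<close>. Both
  need more eigenvalues than there are in dimension two, where they vanish
  (\<open>frame_vanishes_dimension_2\<close>). For \<open>H\<close> the identity and \<open>G\<close> a unit vector they are
  \<open>(d - 1) (d - 2)\<close> and \<open>d (d - 1) (d - 2)\<close> (\<open>frame_identity_hessian\<close>), which is nonzero in dimension
  \<open>d > 2\<close>. These data occur at any point of any manifold, since a smooth function can be given an
  arbitrary value, gradient and symmetric Hessian at one point (\<open>prescribed_second_order_jet\<close>).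

  The Hessian is defined through extensions of tangent vectors to global vector fields. That these
  exist and that the result depends on the tangent vectors alone (\<open>hessian_vector_fields\<close>) rests on
  bump functions, by which coordinates and coordinate fields of a chart are cut off to global smooth
  objects (\<open>extend_by_zero_smooth\<close>, \<open>cutoff_expansion\<close>, \<open>connection_tensorial\<close>).
\<close>


section \<open>Calculus of smooth functions\<close>

lemma k_smooth_on_subset:
  "k_smooth_on S k f \<Longrightarrow> T \<subseteq> S \<Longrightarrow> k_smooth_on T k f"
proof (induction k arbitrary: f)
  case 0
  then show ?case by (auto intro: continuous_on_subset)
next
  case (Suc k)
  then show ?case by auto
qed

text \<open>On an open set a derivative depends only on the values of the function there. This allows a
  function to be replaced by a formula for it that holds on \<open>S\<close> alone.\<close>

lemma k_smooth_on_cong: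
  assumes "open S" "k_smooth_on S k f" "\<And>x. x \<in> S \<Longrightarrow> f x = g x"
  shows "k_smooth_on S k g"
  using assms(2,3)
proof (induction k arbitrary: f g)
  case 0
  then show ?case using continuous_on_cong[of S S f g] by simp
next
  case (Suc k)
  have d: "(g has_derivative frechet_derivative f (at x)) (at x)" if "x \<in> S" for x
  proof -
    have "(f has_derivative frechet_derivative f (at x)) (at x)"
      using Suc.prems(1) that frechet_derivative_works by auto
    then show ?thesis
      using has_derivative_transform_within_open[OF _ assms(1) that] Suc.prems(2) by blast
  qed
  have "frechet_derivative f (at x) v = frechet_derivative g (at x) v" if "x \<in> S" for x v
    using frechet_derivative_at[OF d[OF that]] by simp
  then have "k_smooth_on S k (\<lambda>x. frechet_derivative g (at x) v)" for v
    using Suc.IH[of "\<lambda>x. frechet_derivative f (at x) v" "\<lambda>x. frechet_derivative g (at x) v"]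
      Suc.prems(1) by auto
  then show ?case using d by (auto simp: differentiable_def)
qed

lemma k_smooth_on_SucI:
  assumes "open S" "\<And>x. x \<in> S \<Longrightarrow> (f has_derivative f' x) (at x)"
    and "\<And>v. k_smooth_on S k (\<lambda>x. f' x v)"
  shows "k_smooth_on S (Suc k) f"
proof -
  have "k_smooth_on S k (\<lambda>x. frechet_derivative f (at x) v)" for v
  proof (rule k_smooth_on_cong[OF assms(1) assms(3)])
    fix x assume "x \<in> S"
    then show "f' x v = frechet_derivative f (at x) v"
      using frechet_derivative_at[OF assms(2)] by metis
  qed
  then show ?thesis using assms(2) by (auto simp: differentiable_def)
qed

lemma k_smooth_on_SucD:
  assumes "k_smooth_on S (Suc k) f"
  shows "\<And>x. x \<in> S \<Longrightarrow> (f has_derivative frechet_derivative f (at x)) (at x)"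
    and "\<And>v. k_smooth_on S k (\<lambda>x. frechet_derivative f (at x) v)"
  using assms frechet_derivative_works by auto

text \<open>In the product and chain rules the undifferentiated factors must be \<open>k\<close> times differentiable
  when they are known to be \<open>Suc k\<close> times differentiable.\<close>

lemma k_smooth_on_mono:
  "k_smooth_on S (Suc k) f \<Longrightarrow> k_smooth_on S k f"
proof (induction k arbitrary: f)
  case 0
  then show ?case
    by (auto intro!: continuous_at_imp_continuous_on differentiable_imp_continuous_within)
next
  case (Suc k)
  then show ?case by auto
qed

lemma k_smooth_on_Union:
  assumes "\<And>S. S \<in> \<S> \<Longrightarrow> open S" "\<And>S. S \<in> \<S> \<Longrightarrow> k_smooth_on S k f"
  shows "k_smooth_on (\<Union>\<S>) k f"
  using assms(2)
proof (induction k arbitrary: f)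
  case 0
  then show ?case
    using continuous_on_open_Union[of \<S> f] assms(1) by auto
next
  case (Suc k)
  then show ?case by auto
qed

lemma k_smooth_on_const: "open S \<Longrightarrow> k_smooth_on S k (\<lambda>x. c)"
  by (induction k arbitrary: c) (auto simp: frechet_derivative_const)

lemma k_smooth_on_linear:
  assumes "open S" "bounded_linear L"
  shows "k_smooth_on S k L"
proof (cases k)
  case 0
  then show ?thesis using assms by (simp add: linear_continuous_on)
next
  case (Suc j)
  show ?thesis unfolding Suc
    using k_smooth_on_SucI[OF assms(1), of L "\<lambda>x. L"] assms
      bounded_linear_imp_has_derivative k_smooth_on_const by blast
qed

lemma k_smooth_on_add:
  assumes "open S"
  shows "k_smooth_on S k f \<Longrightarrow> k_smooth_on S k g \<Longrightarrow> k_smooth_on S k (\<lambda>x. f x + g x)"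
proof (induction k arbitrary: f g)
  case 0
  then show ?case by (simp add: continuous_on_add)
next
  case (Suc k)
  note f = k_smooth_on_SucD[OF Suc.prems(1)] and g = k_smooth_on_SucD[OF Suc.prems(2)]
  show ?case
    by (rule k_smooth_on_SucI[OF assms has_derivative_add[OF f(1) g(1)] Suc.IH[OF f(2) g(2)]])
qed

lemma k_smooth_on_sum:
  assumes "open S" "\<And>i. i \<in> I \<Longrightarrow> k_smooth_on S k (f i)"
  shows "k_smooth_on S k (\<lambda>x. \<Sum>i\<in>I. f i x)"
  using assms(2)
proof (induction I rule: infinite_finite_induct)
  case (infinite A)
  then show ?case by (simp add: k_smooth_on_const[OF assms(1)])
next
  case empty
  then show ?case by (simp add: k_smooth_on_const[OF assms(1)])
next
  case (insert i I)
  then show ?case by (simp add: k_smooth_on_add[OF assms(1)])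
qed

lemma k_smooth_on_bilinear:
  assumes "open S" "bounded_bilinear m"
  shows "k_smooth_on S k f \<Longrightarrow> k_smooth_on S k g \<Longrightarrow> k_smooth_on S k (\<lambda>x. m (f x) (g x))"
proof (induction k arbitrary: f g)
  case 0
  then show ?case
    by (simp add: bounded_bilinear.continuous_on[OF assms(2)])
next
  case (Suc k)
  note f = k_smooth_on_SucD[OF Suc.prems(1)] and g = k_smooth_on_SucD[OF Suc.prems(2)]
  note mono = k_smooth_on_mono[OF Suc.prems(1)] k_smooth_on_mono[OF Suc.prems(2)]
  show ?case
  proof (rule k_smooth_on_SucI[OF assms(1) bounded_bilinear.FDERIV[OF assms(2) f(1) g(1)]])
    fix v
    show "k_smooth_on S k (\<lambda>x. m (f x) (frechet_derivative g (at x) v)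
            + m (frechet_derivative f (at x) v) (g x))"
      by (intro k_smooth_on_add[OF assms(1)] Suc.IH mono f(2) g(2))
  qed auto
qed

text \<open>The chain rule gives a derivative \<open>Dg (f x) (Df x v)\<close> whose direction varies with \<open>x\<close>.
  Written over a basis as \<open>\<Sum>b. (Df x v \<bullet> b) *\<^sub>R Dg (f x) b\<close>, it becomes a sum of products of \<open>k\<close> times
  differentiable functions, because the induction hypothesis applies to each \<open>x \<mapsto> Dg (f x) b\<close>.\<close>

lemma k_smooth_on_compose:
  fixes f :: "'a::real_normed_vector \<Rightarrow> 'b::euclidean_space"
    and g :: "'b \<Rightarrow> 'c::real_normed_vector"
  assumes "open S" "open T" "f ` S \<subseteq> T"
  shows "k_smooth_on S k f \<Longrightarrow> k_smooth_on T k g \<Longrightarrow> k_smooth_on S k (\<lambda>x. g (f x))"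
proof (induction k arbitrary: g)
  case 0
  then show ?case using assms(3) by (auto intro: continuous_on_compose2)
next
  case (Suc k)
  note f = k_smooth_on_SucD[OF Suc.prems(1)] and g = k_smooth_on_SucD[OF Suc.prems(2)]
  define d where "d = (\<lambda>x v. \<Sum>b\<in>Basis. (frechet_derivative f (at x) v \<bullet> b) *\<^sub>R
      frechet_derivative g (at (f x)) b)"
  have "((\<lambda>x. g (f x)) has_derivative d x) (at x)" if "x \<in> S" for x
  proof -
    have fx: "f x \<in> T" using that assms(3) by auto
    have lin: "linear (frechet_derivative g (at (f x)))"
      using g(1)[OF fx] has_derivative_linear by blast
    have "((\<lambda>x. g (f x)) has_derivative
        (\<lambda>v. frechet_derivative g (at (f x)) (frechet_derivative f (at x) v))) (at x)"
      using has_derivative_compose[OF f(1)[OF that] g(1)[OF fx]] .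
    moreover have "frechet_derivative g (at (f x)) w =
        (\<Sum>b\<in>Basis. (w \<bullet> b) *\<^sub>R frechet_derivative g (at (f x)) b)" for w
      using linear_sum[OF lin, of "\<lambda>b. (w \<bullet> b) *\<^sub>R b" Basis]
      by (simp add: euclidean_representation linear_cmul[OF lin])
    from this[symmetric] have "d x = (\<lambda>v. frechet_derivative g (at (f x)) (frechet_derivative f (at x) v))"
      by (auto simp: d_def fun_eq_iff)
    ultimately show ?thesis by simp
  qed
  moreover have "k_smooth_on S k (\<lambda>x. d x v)" for v
    unfolding d_def
  proof (intro k_smooth_on_sum[OF assms(1)])
    fix b :: 'b assume "b \<in> Basis"
    have 1: "k_smooth_on S k (\<lambda>x. frechet_derivative f (at x) v \<bullet> b)"
      by (rule k_smooth_on_bilinear[OF assms(1) bounded_bilinear_inner f(2)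
            k_smooth_on_const[OF assms(1)]])
    have 2: "k_smooth_on S k (\<lambda>x. frechet_derivative g (at (f x)) b)"
      by (rule Suc.IH[OF k_smooth_on_mono[OF Suc.prems(1)] g(2)])
    show "k_smooth_on S k (\<lambda>x. (frechet_derivative f (at x) v \<bullet> b) *\<^sub>R
        frechet_derivative g (at (f x)) b)"
      by (rule k_smooth_on_bilinear[OF assms(1) bounded_bilinear_scaleR 1 2])
  qed
  ultimately show ?case by (rule k_smooth_on_SucI[OF assms(1)])
qed

lemma smooth_on_subset: "smooth_on S f \<Longrightarrow> T \<subseteq> S \<Longrightarrow> smooth_on T f"
  unfolding smooth_on_def using k_smooth_on_subset by blast

lemma smooth_on_cong:
  "open S \<Longrightarrow> smooth_on S f \<Longrightarrow> (\<And>x. x \<in> S \<Longrightarrow> f x = g x) \<Longrightarrow> smooth_on S g"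
  unfolding smooth_on_def using k_smooth_on_cong by blast

lemma smooth_on_local:
  assumes "\<And>x. x \<in> S \<Longrightarrow> \<exists>T. open T \<and> x \<in> T \<and> smooth_on T f"
  shows "smooth_on S f"
proof -
  have "smooth_on (\<Union>{T. open T \<and> smooth_on T f}) f"
    unfolding smooth_on_def by (auto intro!: k_smooth_on_Union simp: smooth_on_def)
  then show ?thesis by (rule smooth_on_subset) (use assms in blast)
qed

lemma smooth_on_const: "open S \<Longrightarrow> smooth_on S (\<lambda>x. c)"
  unfolding smooth_on_def using k_smooth_on_const by blast

lemma smooth_on_linear: "open S \<Longrightarrow> bounded_linear L \<Longrightarrow> smooth_on S L"
  unfolding smooth_on_def using k_smooth_on_linear by blast

lemma smooth_on_add:
  "open S \<Longrightarrow> smooth_on S f \<Longrightarrow> smooth_on S g \<Longrightarrow> smooth_on S (\<lambda>x. f x + g x)"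
  unfolding smooth_on_def using k_smooth_on_add by blast

lemma smooth_on_mult:
  fixes f g :: "'a::real_normed_vector \<Rightarrow> real"
  shows "open S \<Longrightarrow> smooth_on S f \<Longrightarrow> smooth_on S g \<Longrightarrow> smooth_on S (\<lambda>x. f x * g x)"
  unfolding smooth_on_def using k_smooth_on_bilinear[OF _ bounded_bilinear_mult] by blast

lemma smooth_on_inner:
  fixes f g :: "'a::real_normed_vector \<Rightarrow> 'b::euclidean_space"
  shows "open S \<Longrightarrow> smooth_on S f \<Longrightarrow> smooth_on S g \<Longrightarrow> smooth_on S (\<lambda>x. f x \<bullet> g x)"
  unfolding smooth_on_def using k_smooth_on_bilinear[OF _ bounded_bilinear_inner] by blast

lemma smooth_on_compose:
  fixes f :: "'a::real_normed_vector \<Rightarrow> 'b::euclidean_space"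
  shows "open S \<Longrightarrow> open T \<Longrightarrow> f ` S \<subseteq> T \<Longrightarrow> smooth_on S f \<Longrightarrow> smooth_on T g \<Longrightarrow>
    smooth_on S (\<lambda>x. g (f x))"
  unfolding smooth_on_def using k_smooth_on_compose by blast

lemma smooth_on_has_derivative:
  "smooth_on S f \<Longrightarrow> x \<in> S \<Longrightarrow> (f has_derivative frechet_derivative f (at x)) (at x)"
  unfolding smooth_on_def using k_smooth_on_SucD(1) by blast

lemma smooth_on_frechet_derivative:
  "smooth_on S f \<Longrightarrow> smooth_on S (\<lambda>x. frechet_derivative f (at x) v)"
  unfolding smooth_on_def using k_smooth_on_SucD(2) by blast


section \<open>Bump functions\<close>

text \<open>All derivatives of \<open>t \<mapsto> exp (- 1 / t)\<close> have the form \<open>q (1 / t) exp (- 1 / t)\<close> with a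
  polynomial \<open>q\<close>. Extending this whole family by \<open>0\<close> to \<open>t \<le> 0\<close> gives a set of continuous
  functions that is closed under differentiation, so each of its members is smooth.\<close>

definition flat_exp :: "real poly \<Rightarrow> real \<Rightarrow> real" where
  "flat_exp q t = (if t > 0 then poly q (1 / t) * exp (- 1 / t) else 0)"

lemma poly_times_exp_minus_tendsto_0:
  fixes q :: "real poly"
  shows "((\<lambda>s. poly q s * exp (- s)) \<longlongrightarrow> 0) at_top"
proof -
  have "((\<lambda>s. \<Sum>i\<le>degree q. coeff q i * (s ^ i / exp s)) \<longlongrightarrow> (\<Sum>i\<le>degree q. coeff q i * 0)) at_top"
    by (intro tendsto_sum tendsto_mult tendsto_const tendsto_power_div_exp_0)
  moreover have "(\<lambda>s. poly q s * exp (- s)) = (\<lambda>s. \<Sum>i\<le>degree q. coeff q i * (s ^ i / exp s))"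
    by (auto simp: poly_altdef sum_distrib_right exp_minus divide_simps intro!: sum.cong)
  ultimately show ?thesis by simp
qed

lemma flat_exp_tendsto_0: "(flat_exp q \<longlongrightarrow> 0) (at 0)"
proof -
  have "((\<lambda>t. poly q (inverse t) * exp (- inverse t)) \<longlongrightarrow> 0) (at_right 0)"
    using filterlim_compose[OF poly_times_exp_minus_tendsto_0 filterlim_inverse_at_top_right] .
  then have "(flat_exp q \<longlongrightarrow> 0) (at_right 0)"
    by (rule Lim_transform_eventually)
      (auto simp: flat_exp_def eventually_at_filter divide_inverse)
  moreover have "(flat_exp q \<longlongrightarrow> 0) (at_left 0)"
    by (rule Lim_transform_eventually[OF tendsto_const])
      (auto simp: flat_exp_def eventually_at_filter)
  ultimately show ?thesis by (simp add: filterlim_split_at)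
qed

lemma flat_exp_has_derivative:
  "(flat_exp q has_real_derivative flat_exp (monom 1 2 * (q - pderiv q)) t) (at t)"
proof (cases t "0 :: real" rule: linorder_cases)
  case less
  have "((\<lambda>t. 0) has_real_derivative 0) (at t)" by simp
  then have "(flat_exp q has_real_derivative 0) (at t)"
    by (rule has_field_derivative_transform_within_open[where S = "{..<0}"])
      (use less in \<open>auto simp: flat_exp_def\<close>)
  then show ?thesis using less by (simp add: flat_exp_def)
next
  case equal
  \<comment> \<open>the difference quotient at \<open>0\<close> is again a member of the family, for the polynomial \<open>s q(s)\<close>\<close>
  have "(flat_exp (pCons 0 q) \<longlongrightarrow> 0) (at 0)" by (rule flat_exp_tendsto_0)
  then have "((\<lambda>h. (flat_exp q h - flat_exp q 0) / (h - 0)) \<longlongrightarrow> 0) (at 0)"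
    by (rule Lim_transform_eventually)
      (auto simp: flat_exp_def eventually_at_filter divide_simps)
  then show ?thesis using equal by (simp add: flat_exp_def has_field_derivative_iff)
next
  case greater
  have "((\<lambda>t. poly q (1 / t) * exp (- 1 / t)) has_real_derivative
      flat_exp (monom 1 2 * (q - pderiv q)) t) (at t)"
    using greater
    by (auto intro!: derivative_eq_intros simp: flat_exp_def poly_monom field_simps power2_eq_square)
  then show ?thesis
    by (rule has_field_derivative_transform_within_open[where S = "{0<..}"])
      (use greater in \<open>auto simp: flat_exp_def\<close>)
qed

lemma smooth_on_flat_exp: "smooth_on UNIV (flat_exp q)"
proof -
  have "k_smooth_on UNIV k (flat_exp q)" for k
  proof (induction k arbitrary: q)
    case 0
    show ?case
      by (simp add: continuous_at_imp_continuous_on DERIV_isCont[OF flat_exp_has_derivative])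
  next
    case (Suc k)
    show ?case
    proof (rule k_smooth_on_SucI)
      show "(flat_exp q has_derivative (*) (flat_exp (monom 1 2 * (q - pderiv q)) t)) (at t)" for t
        using flat_exp_has_derivative[of q t] by (simp add: has_field_derivative_def)
      show "k_smooth_on UNIV k (\<lambda>t. flat_exp (monom 1 2 * (q - pderiv q)) t * v)" for v
        by (intro k_smooth_on_bilinear[OF _ bounded_bilinear_mult] Suc.IH k_smooth_on_const) auto
    qed simp
  qed
  then show ?thesis by (simp add: smooth_on_def)
qed

text \<open>The function is \<open>exp (- 1 / (r\<^sup>2 - |z - a|\<^sup>2))\<close> inside the ball, normalised to be \<open>1\<close> at the
  centre.\<close>

lemma bump_function_exists:
  fixes a :: "'a::euclidean_space"
  assumes "r > 0"
  obtains \<psi> :: "'a \<Rightarrow> real" where "smooth_on UNIV \<psi>" "\<psi> a = 1" "\<And>z. z \<notin> cball a r \<Longrightarrow> \<psi> z = 0"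
proof
  define \<psi> where "\<psi> = (\<lambda>z. exp (1 / r\<^sup>2) * flat_exp 1 (r\<^sup>2 + (- 1) * ((z + - a) \<bullet> (z + - a))))"
  have "smooth_on UNIV (\<lambda>z::'a. z + - a)"
    by (intro smooth_on_add smooth_on_const smooth_on_linear bounded_linear_ident) auto
  from smooth_on_inner[OF open_UNIV this this]
  have "smooth_on UNIV (\<lambda>z. r\<^sup>2 + (- 1) * ((z + - a) \<bullet> (z + - a)))"
    by (intro smooth_on_add[OF open_UNIV] smooth_on_mult[OF open_UNIV] smooth_on_const open_UNIV)
  from smooth_on_compose[OF open_UNIV open_UNIV _ this smooth_on_flat_exp[of 1]]
  have *: "smooth_on UNIV (\<lambda>z. flat_exp 1 (r\<^sup>2 + (- 1) * ((z + - a) \<bullet> (z + - a))))"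
    by simp
  show "smooth_on UNIV \<psi>"
    unfolding \<psi>_def by (intro smooth_on_mult[OF _ _ *] smooth_on_const) auto
  show "\<psi> a = 1"
    using assms by (simp add: \<psi>_def flat_exp_def exp_minus)
  show "\<psi> z = 0" if "z \<notin> cball a r" for z
  proof -
    have "r < norm (z - a)" using that by (simp add: dist_norm norm_minus_commute)
    then have "r\<^sup>2 < (z - a) \<bullet> (z - a)"
      using assms by (simp add: power2_norm_eq_inner[symmetric] power_strict_mono)
    then show ?thesis by (simp add: \<psi>_def flat_exp_def)
  qed
qed


section \<open>Smooth functions on a manifold\<close>

locale smooth_manifold =
  fixes A :: "('m::t2_space, 'n::finite) chart set"
  assumes atlas: "smooth_atlas A"
begin

lemma chart:
  assumes "(U, x) \<in> A"
  shows chart_open: "open U" "open (x ` U)"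
    and chart_inj: "inj_on x U"
    and chart_continuous: "continuous_on U x" "continuous_on (x ` U) (inv_into U x)"
proof -
  have "is_chart (U, x)" using atlas assms unfolding smooth_atlas_def by blast
  then show "open U" "open (x ` U)" "continuous_on U x" "continuous_on (x ` U) (inv_into U x)"
    by (auto simp: is_chart_def homeomorphism_def)
  show "inj_on x U"
    using \<open>is_chart (U, x)\<close> by (auto simp: is_chart_def homeomorphism_def intro!: inj_on_inverseI)
qed

lemma chart_inv [simp]: "(U, x) \<in> A \<Longrightarrow> p \<in> U \<Longrightarrow> inv_into U x (x p) = p"
  using chart_inj inv_into_f_f by metis

lemma chart_exists: obtains U x where "(U, x) \<in> A" "p \<in> U"
proof -
  have "p \<in> (\<Union>c\<in>A. fst c)" using atlas unfolding smooth_atlas_def by simp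
  then show ?thesis using that by auto
qed

lemma chart_change_smooth:
  "(U, x) \<in> A \<Longrightarrow> (V, y) \<in> A \<Longrightarrow> smooth_on (x ` (U \<inter> V)) (y \<circ> inv_into U x)"
  using atlas unfolding smooth_atlas_def by blast

lemma chart_open_image:
  assumes "(U, x) \<in> A" "open W"
  shows "open (x ` (U \<inter> W))"
proof -
  have "x ` (U \<inter> W) = x ` U \<inter> inv_into U x -` W"
    using assms(1) by force
  then show ?thesis
    using continuous_open_preimage[OF chart_continuous(2) chart_open(2) assms(2)] assms(1) by metis
qed

lemma smooth_functions_rep:
  "f \<in> smooth_functions A \<Longrightarrow> (U, x) \<in> A \<Longrightarrow> smooth_on (x ` U) (f \<circ> inv_into U x)"
  unfolding smooth_functions_def by blast

lemma smooth_functionsI: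
  "(\<And>U x. (U, x) \<in> A \<Longrightarrow> smooth_on (x ` U) (f \<circ> inv_into U x)) \<Longrightarrow> f \<in> smooth_functions A"
  unfolding smooth_functions_def by blast

lemma smooth_functions_const: "(\<lambda>q. c) \<in> smooth_functions A"
  by (auto intro!: smooth_functionsI smooth_on_const chart_open simp: o_def)

lemma smooth_functions_add:
  assumes "f \<in> smooth_functions A" "h \<in> smooth_functions A"
  shows "(\<lambda>q. f q + h q) \<in> smooth_functions A"
  using assms[THEN smooth_functions_rep]
  by (auto intro!: smooth_functionsI smooth_on_add chart_open simp: o_def)

lemma smooth_functions_mult:
  assumes "f \<in> smooth_functions A" "h \<in> smooth_functions A"
  shows "(\<lambda>q. f q * h q) \<in> smooth_functions A"
  using assms[THEN smooth_functions_rep]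
  by (auto intro!: smooth_functionsI smooth_on_mult chart_open simp: o_def)

lemma smooth_functions_scale:
  "f \<in> smooth_functions A \<Longrightarrow> (\<lambda>q. c * f q) \<in> smooth_functions A"
  by (intro smooth_functions_mult smooth_functions_const)

lemma smooth_functions_diff:
  assumes "f \<in> smooth_functions A" "h \<in> smooth_functions A"
  shows "(\<lambda>q. f q - h q) \<in> smooth_functions A"
  using smooth_functions_add[OF assms(1) smooth_functions_scale[OF assms(2), of "- 1"]] by simp

lemma smooth_functions_sum:
  "(\<And>i. i \<in> I \<Longrightarrow> f i \<in> smooth_functions A) \<Longrightarrow> (\<lambda>q. \<Sum>i\<in>I. f i q) \<in> smooth_functions A"
  by (induction I rule: infinite_finite_induct)
    (auto simp: smooth_functions_const smooth_functions_add)

text \<open>Functions are made on \<open>M\<close> by extending a compactly supported function of the coordinates by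
  zero. The extension is smooth across the boundary of \<open>U\<close> because the support is compact in \<open>M\<close>,
  hence closed, as \<open>M\<close> is Hausdorff.\<close>

definition extend_by_zero :: "'m set \<Rightarrow> ('m \<Rightarrow> real^'n) \<Rightarrow> (real^'n \<Rightarrow> real) \<Rightarrow> 'm \<Rightarrow> real" where
  "extend_by_zero U x F = (\<lambda>q. if q \<in> U then F (x q) else 0)"

lemma extend_by_zero_smooth:
  assumes c: "(U, x) \<in> A" and K: "compact K" "K \<subseteq> x ` U"
    and F: "smooth_on (x ` U) F" "\<And>z. z \<in> x ` U \<Longrightarrow> z \<notin> K \<Longrightarrow> F z = 0"
  shows "extend_by_zero U x F \<in> smooth_functions A"
proof (rule smooth_functionsI)
  fix V y assume c': "(V, y) \<in> A"
  define L where "L = inv_into U x ` K"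
  have "compact L"
    unfolding L_def using K chart_continuous(2)[OF c]
    by (intro compact_continuous_image) (auto intro: continuous_on_subset)
  then have "open (- L)" by (simp add: compact_imp_closed open_Compl)
  have zero: "extend_by_zero U x F q = 0" if "q \<notin> L" for q
  proof (cases "q \<in> U")
    case True
    then have "x q \<notin> K" using that chart_inv[OF c True] unfolding L_def by (metis imageI)
    then show ?thesis using F(2) True by (simp add: extend_by_zero_def)
  qed (simp add: extend_by_zero_def)
  show "smooth_on (y ` V) (extend_by_zero U x F \<circ> inv_into V y)"
  proof (rule smooth_on_local)
    fix z assume "z \<in> y ` V"
    then obtain q where q: "q \<in> V" "z = y q" by blast
    \<comment> \<open>\<open>V\<close> is covered by \<open>V \<inter> U\<close>, where \<open>F\<close> composed with a chart change represents the extension,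
      and \<open>V - L\<close>, where the extension is zero\<close>
    show "\<exists>T. open T \<and> z \<in> T \<and> smooth_on T (extend_by_zero U x F \<circ> inv_into V y)"
    proof (cases "q \<in> U")
      case True
      let ?T = "y ` (V \<inter> U)"
      have T: "open ?T" using chart_open_image[OF c' chart_open(1)[OF c]] .
      have "smooth_on ?T (\<lambda>z. F ((x \<circ> inv_into V y) z))"
      proof (rule smooth_on_compose[OF T chart_open(2)[OF c] _ _ F(1)])
        show "smooth_on ?T (x \<circ> inv_into V y)"
          by (rule chart_change_smooth[OF c' c])
      qed (use c' in auto)
      then have "smooth_on ?T (extend_by_zero U x F \<circ> inv_into V y)"
        by (rule smooth_on_cong[OF T]) (use c' in \<open>auto simp: extend_by_zero_def\<close>)
      then show ?thesis using T True q by blast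
    next
      case False
      let ?T = "y ` (V \<inter> - L)"
      have T: "open ?T" using chart_open_image[OF c' \<open>open (- L)\<close>] .
      have "smooth_on ?T (extend_by_zero U x F \<circ> inv_into V y)"
        by (rule smooth_on_cong[OF T smooth_on_const[OF T, of 0]]) (use c' zero in auto)
      moreover have "L \<subseteq> U" unfolding L_def using K(2) by (auto intro: inv_into_into)
      then have "q \<notin> L" using False by blast
      ultimately show ?thesis using T q by blast
    qed
  qed
qed

lemma chart_bump:
  assumes "(U, x) \<in> A" "p \<in> U"
  obtains \<psi> K where "smooth_on UNIV \<psi>" "\<psi> (x p) = (1::real)" "compact K" "K \<subseteq> x ` U"
    "\<And>z. z \<notin> K \<Longrightarrow> \<psi> z = 0"
proof -
  obtain r where r: "r > 0" "cball (x p) r \<subseteq> x ` U"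
    using open_contains_cball[of "x ` U"] chart_open(2)[OF assms(1)] assms(2) by blast
  obtain \<psi> :: "real^'n \<Rightarrow> real" where \<psi>: "smooth_on UNIV \<psi>" "\<psi> (x p) = 1"
    "\<And>z. z \<notin> cball (x p) r \<Longrightarrow> \<psi> z = 0"
    using bump_function_exists[OF r(1), of "x p"] by blast
  show ?thesis using that[OF \<psi>(1,2) compact_cball r(2) \<psi>(3)] .
qed


section \<open>Tangent vectors\<close>

lemma coord_vector_apply:
  "f \<in> smooth_functions A \<Longrightarrow>
    coord_vector A (U, x) p a f = frechet_derivative (f \<circ> inv_into U x) (at (x p)) a"
  by (simp add: coord_vector_def)

lemma coord_vector_not_smooth:
  "f \<notin> smooth_functions A \<Longrightarrow> coord_vector A c p a f = 0"
  by (auto simp: coord_vector_def split: prod.split)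

lemma smooth_functions_has_derivative:
  assumes "f \<in> smooth_functions A" "(U, x) \<in> A" "p \<in> U"
  shows "((f \<circ> inv_into U x) has_derivative (\<lambda>a. coord_vector A (U, x) p a f)) (at (x p))"
  using smooth_on_has_derivative[OF smooth_functions_rep[OF assms(1,2)], of "x p"] assms
  by (simp add: coord_vector_apply)

lemma coord_vector_lincomb:
  assumes "(U, x) \<in> A" "p \<in> U"
  shows "coord_vector A (U, x) p (s *\<^sub>R a + t *\<^sub>R b) =
    (\<lambda>f. s * coord_vector A (U, x) p a f + t * coord_vector A (U, x) p b f)"
proof
  fix f
  show "coord_vector A (U, x) p (s *\<^sub>R a + t *\<^sub>R b) f =
    s * coord_vector A (U, x) p a f + t * coord_vector A (U, x) p b f"
  proof (cases "f \<in> smooth_functions A")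
    case True
    note lin = has_derivative_linear[OF smooth_functions_has_derivative[OF True assms]]
    show ?thesis by (simp add: linear_add[OF lin] linear_cmul[OF lin])
  qed (simp add: coord_vector_not_smooth)
qed

lemma coord_vector_0: "(U, x) \<in> A \<Longrightarrow> p \<in> U \<Longrightarrow> coord_vector A (U, x) p 0 = (\<lambda>f. 0)"
  using coord_vector_lincomb[of U x p 0 0 0 0] by simp

lemma coord_vector_scale:
  "(U, x) \<in> A \<Longrightarrow> p \<in> U \<Longrightarrow>
    coord_vector A (U, x) p (s *\<^sub>R a) = (\<lambda>f. s * coord_vector A (U, x) p a f)"
  using coord_vector_lincomb[of U x p s a 0 0] by simp

lemma coord_vector_sum:
  assumes "(U, x) \<in> A" "p \<in> U"
  shows "coord_vector A (U, x) p (\<Sum>i\<in>I. s i *\<^sub>R a i) =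
    (\<lambda>f. \<Sum>i\<in>I. s i * coord_vector A (U, x) p (a i) f)"
proof (induction I rule: infinite_finite_induct)
  case (insert i I)
  have "coord_vector A (U, x) p (\<Sum>i\<in>insert i I. s i *\<^sub>R a i) =
      coord_vector A (U, x) p (s i *\<^sub>R a i + 1 *\<^sub>R (\<Sum>i\<in>I. s i *\<^sub>R a i))"
    using insert.hyps by simp
  then show ?case
    unfolding coord_vector_lincomb[OF assms] insert.IH using insert.hyps by simp
qed (simp_all add: coord_vector_0[OF assms])

text \<open>By the chain rule the Jacobian of the chart change converts components. Hence the coordinate
  vectors of one chart around \<open>p\<close> are all the tangent vectors at \<open>p\<close>.\<close>

lemma coord_vector_change:
  assumes "(U, x) \<in> A" "(V, y) \<in> A" "p \<in> U" "p \<in> V"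
  shows "coord_vector A (V, y) p a =
    coord_vector A (U, x) p (frechet_derivative (x \<circ> inv_into V y) (at (y p)) a)"
proof
  fix f
  show "coord_vector A (V, y) p a f =
    coord_vector A (U, x) p (frechet_derivative (x \<circ> inv_into V y) (at (y p)) a) f"
  proof (cases "f \<in> smooth_functions A")
    case True
    have T: "open (y ` (V \<inter> U))" using chart_open_image assms chart_open(1) by blast
    have yp: "y p \<in> y ` (V \<inter> U)" using assms by blast
    have "((x \<circ> inv_into V y) has_derivative frechet_derivative (x \<circ> inv_into V y) (at (y p)))
        (at (y p))"
      by (rule smooth_on_has_derivative[OF chart_change_smooth[OF assms(2,1)] yp])
    moreover have "((f \<circ> inv_into U x) has_derivative (\<lambda>a. coord_vector A (U, x) p a f))
        (at ((x \<circ> inv_into V y) (y p)))"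
      using smooth_functions_has_derivative[OF True assms(1,3)] assms by simp
    ultimately have "((\<lambda>z. (f \<circ> inv_into U x) ((x \<circ> inv_into V y) z)) has_derivative
        (\<lambda>a. coord_vector A (U, x) p (frechet_derivative (x \<circ> inv_into V y) (at (y p)) a) f))
        (at (y p))"
      by (rule has_derivative_compose)
    then have "((f \<circ> inv_into V y) has_derivative
        (\<lambda>a. coord_vector A (U, x) p (frechet_derivative (x \<circ> inv_into V y) (at (y p)) a) f))
        (at (y p))"
      by (rule has_derivative_transform_within_open[OF _ T yp]) (use assms in auto)
    from has_derivative_unique[OF this smooth_functions_has_derivative[OF True assms(2,4)]]
    show ?thesis by metis
  qed (simp add: coord_vector_not_smooth)
qed

lemma tangent_space_eq:
  assumes "(U, x) \<in> A" "p \<in> U"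
  shows "tangent_space A p = range (coord_vector A (U, x) p)"
proof
  show "tangent_space A p \<subseteq> range (coord_vector A (U, x) p)"
  proof
    fix u assume "u \<in> tangent_space A p"
    then obtain V y a where "(V, y) \<in> A" "p \<in> V" "u = coord_vector A (V, y) p a"
      unfolding tangent_space_def by force
    then show "u \<in> range (coord_vector A (U, x) p)"
      using coord_vector_change[OF assms(1) _ assms(2)] by blast
  qed
  show "range (coord_vector A (U, x) p) \<subseteq> tangent_space A p"
    unfolding tangent_space_def using assms by fastforce
qed

lemma tangent_coord:
  "(U, x) \<in> A \<Longrightarrow> p \<in> U \<Longrightarrow> coord_vector A (U, x) p a \<in> tangent_space A p"
  by (simp add: tangent_space_eq)

lemma tangent_lincomb:
  assumes "u \<in> tangent_space A p" "v \<in> tangent_space A p"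
  shows "(\<lambda>f. s * u f + t * v f) \<in> tangent_space A p"
proof -
  obtain U x where c: "(U, x) \<in> A" "p \<in> U" by (rule chart_exists)
  obtain a b where "u = coord_vector A (U, x) p a" "v = coord_vector A (U, x) p b"
    using assms tangent_space_eq[OF c] by auto
  then show ?thesis
    using tangent_coord[OF c, of "s *\<^sub>R a + t *\<^sub>R b", unfolded coord_vector_lincomb[OF c]]
    by simp
qed

lemma tangent_0: "(\<lambda>f. 0) \<in> tangent_space A p"
proof -
  obtain U x where c: "(U, x) \<in> A" "p \<in> U" by (rule chart_exists)
  show ?thesis using tangent_coord[OF c, of 0] by (simp add: coord_vector_0[OF c])
qed

lemma tangent_scale: "u \<in> tangent_space A p \<Longrightarrow> (\<lambda>f. s * u f) \<in> tangent_space A p"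
  using tangent_lincomb[of u p u s 0] by simp

lemma tangent_sum:
  "(\<And>i. i \<in> I \<Longrightarrow> u i \<in> tangent_space A p) \<Longrightarrow>
    (\<lambda>f. \<Sum>i\<in>I. s i * u i f) \<in> tangent_space A p"
proof (induction I rule: infinite_finite_induct)
  case (insert i I)
  then show ?case
    using tangent_lincomb[of "u i" p "\<lambda>f. \<Sum>i\<in>I. s i * u i f" "s i" 1] by simp
qed (simp_all add: tangent_0)

lemma tangent_const:
  assumes "u \<in> tangent_space A p"
  shows "u (\<lambda>q. k) = 0"
proof -
  obtain U x where c: "(U, x) \<in> A" "p \<in> U" by (rule chart_exists)
  obtain a where "u = coord_vector A (U, x) p a" using assms tangent_space_eq[OF c] by auto
  then show ?thesis by (simp add: coord_vector_apply[OF smooth_functions_const] o_def)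
qed

lemma tangent_add:
  assumes "u \<in> tangent_space A p" "f \<in> smooth_functions A" "h \<in> smooth_functions A"
  shows "u (\<lambda>q. f q + h q) = u f + u h"
proof -
  obtain U x where c: "(U, x) \<in> A" "p \<in> U" by (rule chart_exists)
  obtain a where a: "u = coord_vector A (U, x) p a" using assms tangent_space_eq[OF c] by auto
  have "(((\<lambda>q. f q + h q) \<circ> inv_into U x) has_derivative
      (\<lambda>a. coord_vector A (U, x) p a f + coord_vector A (U, x) p a h)) (at (x p))"
    using has_derivative_add[OF assms(2,3)[THEN smooth_functions_has_derivative, OF c]]
    by (simp add: o_def)
  from has_derivative_unique[OF this
      smooth_functions_has_derivative[OF smooth_functions_add[OF assms(2,3)] c]]
  show ?thesis unfolding a by metis
qed

lemma tangent_mult: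
  assumes "u \<in> tangent_space A p" "f \<in> smooth_functions A" "h \<in> smooth_functions A"
  shows "u (\<lambda>q. f q * h q) = f p * u h + h p * u f"
proof -
  obtain U x where c: "(U, x) \<in> A" "p \<in> U" by (rule chart_exists)
  obtain a where a: "u = coord_vector A (U, x) p a" using assms tangent_space_eq[OF c] by auto
  have "(((\<lambda>q. f q * h q) \<circ> inv_into U x) has_derivative
      (\<lambda>a. f p * coord_vector A (U, x) p a h + coord_vector A (U, x) p a f * h p)) (at (x p))"
    using has_derivative_mult[OF assms(2,3)[THEN smooth_functions_has_derivative, OF c]] c
    by (simp add: o_def)
  from has_derivative_unique[OF this
      smooth_functions_has_derivative[OF smooth_functions_mult[OF assms(2,3)] c]]
  show ?thesis unfolding a by (metis mult.commute)
qed

lemma tangent_cmult: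
  "u \<in> tangent_space A p \<Longrightarrow> f \<in> smooth_functions A \<Longrightarrow> u (\<lambda>q. k * f q) = k * u f"
  using tangent_mult[OF _ smooth_functions_const, of u p f k] tangent_const[of u p k] by simp

lemma tangent_fsum:
  assumes "u \<in> tangent_space A p" "\<And>i. i \<in> I \<Longrightarrow> f i \<in> smooth_functions A"
  shows "u (\<lambda>q. \<Sum>i\<in>I. f i q) = (\<Sum>i\<in>I. u (f i))"
  using assms(2)
proof (induction I rule: infinite_finite_induct)
  case (insert i I)
  then show ?case
    using tangent_add[OF assms(1) _ smooth_functions_sum, of "f i" I f] by simp
qed (simp_all add: tangent_const[OF assms(1)])

lemma coord_vector_extend_by_zero:
  assumes "(U, x) \<in> A" "p \<in> U" "extend_by_zero U x F \<in> smooth_functions A"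
    and "(F has_derivative F') (at (x p))"
  shows "coord_vector A (U, x) p a (extend_by_zero U x F) = F' a"
proof -
  have "((extend_by_zero U x F \<circ> inv_into U x) has_derivative F') (at (x p))"
    by (rule has_derivative_transform_within_open[OF assms(4) chart_open(2)[OF assms(1)]])
      (use assms(1,2) in \<open>auto simp: extend_by_zero_def\<close>)
  from has_derivative_unique[OF this smooth_functions_has_derivative[OF assms(3,1,2)]]
  show ?thesis by metis
qed

text \<open>The coordinates of a chart live on \<open>U\<close> only, while tangent vectors and connections act on
  global objects. A cut-off \<open>\<psi>\<close> around \<open>p\<close> makes coordinate expressions global. It is characterised by
  what it is used for: the product with any smooth coordinate expression extends by zero to a smooth
  function on \<open>M\<close>.\<close>

definition cutoff_chart ::
  "('m, 'n) chart \<Rightarrow> 'm \<Rightarrow> (real^'n \<Rightarrow> real) \<Rightarrow> bool" where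
  "cutoff_chart c p \<psi> \<longleftrightarrow> (case c of (U, x) \<Rightarrow> (U, x) \<in> A \<and> p \<in> U \<and>
     smooth_on UNIV \<psi> \<and> \<psi> (x p) = 1 \<and>
     (\<forall>F. smooth_on (x ` U) F \<longrightarrow> extend_by_zero U x (\<lambda>z. \<psi> z * F z) \<in> smooth_functions A))"

lemma cutoff_chart_exists:
  assumes "(U, x) \<in> A" "p \<in> U"
  obtains \<psi> where "cutoff_chart (U, x) p \<psi>"
proof -
  obtain \<psi> K where \<psi>: "smooth_on UNIV \<psi>" "\<psi> (x p) = (1::real)" "compact K" "K \<subseteq> x ` U"
    "\<And>z. z \<notin> K \<Longrightarrow> \<psi> z = 0"
    using chart_bump[OF assms] by blast
  have "extend_by_zero U x (\<lambda>z. \<psi> z * F z) \<in> smooth_functions A" if "smooth_on (x ` U) F" for F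
    using \<psi> that chart_open(2)[OF assms(1)]
    by (intro extend_by_zero_smooth[OF assms(1) \<psi>(3,4)] smooth_on_mult)
      (auto intro: smooth_on_subset)
  then show ?thesis using that[of \<psi>] \<psi> assms by (simp add: cutoff_chart_def)
qed

text \<open>These are the linear coordinates \<open>b \<bullet> x\<close>, centred at \<open>p\<close> and cut off. Their differentials at \<open>p\<close>
  are the \<open>b \<bullet> dx\<close>, since \<open>\<psi>\<close> has value \<open>1\<close> there and the factor \<open>b \<bullet> (x - x p)\<close> vanishes.\<close>

definition cutoff_coord :: "('m, 'n) chart \<Rightarrow> 'm \<Rightarrow> (real^'n \<Rightarrow> real) \<Rightarrow> real^'n \<Rightarrow> 'm \<Rightarrow> real" where
  "cutoff_coord c p \<psi> b = extend_by_zero (fst c) (snd c) (\<lambda>z. \<psi> z * (b \<bullet> (z - snd c p)))"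

lemma cutoff_coord:
  assumes "cutoff_chart (U, x) p \<psi>"
  shows cutoff_coord_smooth: "cutoff_coord (U, x) p \<psi> b \<in> smooth_functions A"
    and cutoff_smooth: "extend_by_zero U x \<psi> \<in> smooth_functions A"
    and cutoff_coord_center: "cutoff_coord (U, x) p \<psi> b p = 0"
    and coord_vector_cutoff_coord: "q \<in> U \<Longrightarrow>
      coord_vector A (U, x) q a (cutoff_coord (U, x) p \<psi> b) =
      \<psi> (x q) * (b \<bullet> a) + (b \<bullet> (x q - x p)) * coord_vector A (U, x) q a (extend_by_zero U x \<psi>)"
proof -
  have c: "(U, x) \<in> A" "p \<in> U" and \<psi>: "smooth_on UNIV \<psi>" "\<psi> (x p) = 1"
    and sm: "\<And>F. smooth_on (x ` U) F \<Longrightarrow> extend_by_zero U x (\<lambda>z. \<psi> z * F z) \<in> smooth_functions A"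
    using assms by (auto simp: cutoff_chart_def)
  note S = chart_open(2)[OF c(1)]
  have "smooth_on (x ` U) (\<lambda>z. b \<bullet> z + - (b \<bullet> x p))"
    by (intro smooth_on_add[OF S] smooth_on_const[OF S]
        smooth_on_linear[OF S bounded_linear_inner_right])
  then have 1: "extend_by_zero U x (\<lambda>z. \<psi> z * (b \<bullet> (z - x p))) \<in> smooth_functions A"
    using sm[of "\<lambda>z. b \<bullet> (z - x p)"] by (simp add: inner_diff_right)
  then show "cutoff_coord (U, x) p \<psi> b \<in> smooth_functions A"
    by (simp add: cutoff_coord_def)
  show 2: "extend_by_zero U x \<psi> \<in> smooth_functions A"
    using sm[OF smooth_on_const[OF S, of 1]] by simp
  show "cutoff_coord (U, x) p \<psi> b p = 0"
    by (simp add: cutoff_coord_def extend_by_zero_def)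
  show "coord_vector A (U, x) q a (cutoff_coord (U, x) p \<psi> b) =
      \<psi> (x q) * (b \<bullet> a) + (b \<bullet> (x q - x p)) * coord_vector A (U, x) q a (extend_by_zero U x \<psi>)"
    if q: "q \<in> U"
  proof -
    define \<psi>' where "\<psi>' = frechet_derivative \<psi> (at (x q))"
    have d: "(\<psi> has_derivative \<psi>') (at (x q))"
      unfolding \<psi>'_def by (rule smooth_on_has_derivative[OF \<psi>(1)]) simp
    have "((\<lambda>z. \<psi> z * (b \<bullet> (z - x p))) has_derivative
        (\<lambda>a. \<psi> (x q) * (b \<bullet> a) + \<psi>' a * (b \<bullet> (x q - x p)))) (at (x q))"
      by (rule has_derivative_mult[OF d]) (auto intro!: derivative_eq_intros)
    from coord_vector_extend_by_zero[OF c(1) q 1 this] coord_vector_extend_by_zero[OF c(1) q 2 d]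
    show ?thesis by (simp add: cutoff_coord_def)
  qed
qed

text \<open>The cut-off coordinates recover all components of a tangent vector.\<close>

lemma coord_vector_inj:
  assumes "(U, x) \<in> A" "p \<in> U"
  shows "inj (coord_vector A (U, x) p)"
proof (rule injI)
  fix a b assume eq: "coord_vector A (U, x) p a = coord_vector A (U, x) p b"
  obtain \<psi> where \<psi>: "cutoff_chart (U, x) p \<psi>" by (rule cutoff_chart_exists[OF assms])
  have "coord_vector A (U, x) p a (cutoff_coord (U, x) p \<psi> e) = e \<bullet> a" for a e
    using coord_vector_cutoff_coord[OF \<psi> assms(2)] \<psi> by (simp add: cutoff_chart_def)
  then have "e \<bullet> a = e \<bullet> b" for e using eq by metis
  then show "a = b" by (metis vector_eq_rdot inner_commute)
qed

section \<open>Vector fields and tensoriality of a connection\<close>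

lemma vector_field_tangent: "X \<in> vector_fields A \<Longrightarrow> X p \<in> tangent_space A p"
  unfolding vector_fields_def by blast

lemma vector_field_smooth:
  "X \<in> vector_fields A \<Longrightarrow> f \<in> smooth_functions A \<Longrightarrow> (\<lambda>p. X p f) \<in> smooth_functions A"
  unfolding vector_fields_def by blast

lemma vector_fieldI:
  "(\<And>p. X p \<in> tangent_space A p) \<Longrightarrow>
    (\<And>f. f \<in> smooth_functions A \<Longrightarrow> (\<lambda>p. X p f) \<in> smooth_functions A) \<Longrightarrow> X \<in> vector_fields A"
  unfolding vector_fields_def by blast

lemma vf_add_in:
  assumes "X \<in> vector_fields A" "Y \<in> vector_fields A"
  shows "vf_add X Y \<in> vector_fields A"
proof (rule vector_fieldI)
  fix p
  show "vf_add X Y p \<in> tangent_space A p"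
    using tangent_lincomb[OF assms[THEN vector_field_tangent[where p = p]], of 1 1] by (simp add: vf_add_def)
next
  fix f assume "f \<in> smooth_functions A"
  then show "(\<lambda>p. vf_add X Y p f) \<in> smooth_functions A"
    using smooth_functions_add[OF assms[THEN vector_field_smooth]] by (simp add: vf_add_def)
qed

lemma vf_scale_in:
  assumes "h \<in> smooth_functions A" "X \<in> vector_fields A"
  shows "vf_scale h X \<in> vector_fields A"
proof (rule vector_fieldI)
  fix p
  show "vf_scale h X p \<in> tangent_space A p"
    using tangent_scale[OF vector_field_tangent[OF assms(2), of p], of "h p"] by (simp add: vf_scale_def)
next
  fix f assume "f \<in> smooth_functions A"
  then show "(\<lambda>p. vf_scale h X p f) \<in> smooth_functions A"
    using smooth_functions_mult[OF assms(1) vector_field_smooth[OF assms(2)]]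
    by (simp add: vf_scale_def)
qed

lemma vf_0: "(\<lambda>p f. 0) \<in> vector_fields A"
  by (intro vector_fieldI tangent_0 smooth_functions_const)

lemma vf_sum_in:
  assumes "\<And>i. i \<in> I \<Longrightarrow> k i \<in> smooth_functions A" "\<And>i. i \<in> I \<Longrightarrow> E i \<in> vector_fields A"
  shows "(\<lambda>p f. \<Sum>i\<in>I. k i p * E i p f) \<in> vector_fields A"
proof (rule vector_fieldI)
  show "(\<lambda>f. \<Sum>i\<in>I. k i p * E i p f) \<in> tangent_space A p" for p
    by (intro tangent_sum vector_field_tangent assms)
  show "(\<lambda>p. \<Sum>i\<in>I. k i p * E i p f) \<in> smooth_functions A" if "f \<in> smooth_functions A" for f
    by (rule smooth_functions_sum, rule smooth_functions_mult)
      (simp_all add: assms(1) vector_field_smooth[OF assms(2) that])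
qed

definition cutoff_field ::
  "('m, 'n) chart \<Rightarrow> (real^'n \<Rightarrow> real) \<Rightarrow> real^'n \<Rightarrow> 'm vector_field" where
  "cutoff_field c \<psi> b = (\<lambda>q. if q \<in> fst c then coord_vector A c q (\<psi> (snd c q) *\<^sub>R b) else (\<lambda>f. 0))"

lemma cutoff_field_in:
  assumes "cutoff_chart (U, x) p \<psi>"
  shows "cutoff_field (U, x) \<psi> b \<in> vector_fields A"
proof (rule vector_fieldI)
  have c: "(U, x) \<in> A" using assms by (simp add: cutoff_chart_def)
  fix q
  show "cutoff_field (U, x) \<psi> b q \<in> tangent_space A q"
    using tangent_coord[OF c] tangent_0 by (simp add: cutoff_field_def)
next
  have c: "(U, x) \<in> A" using assms by (simp add: cutoff_chart_def)
  fix f assume f: "f \<in> smooth_functions A"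
  let ?F = "\<lambda>z. frechet_derivative (f \<circ> inv_into U x) (at z) b"
  have "extend_by_zero U x (\<lambda>z. \<psi> z * ?F z) \<in> smooth_functions A"
    using smooth_on_frechet_derivative[OF smooth_functions_rep[OF f c]] assms
    by (simp add: cutoff_chart_def)
  moreover have "extend_by_zero U x (\<lambda>z. \<psi> z * ?F z) = (\<lambda>q. cutoff_field (U, x) \<psi> b q f)"
    by (auto simp: extend_by_zero_def cutoff_field_def coord_vector_scale[OF c]
        coord_vector_apply[OF f])
  ultimately show "(\<lambda>q. cutoff_field (U, x) \<psi> b q f) \<in> smooth_functions A" by simp
qed

text \<open>The Hessian at \<open>p\<close> is defined through vector fields with given values at \<open>p\<close>; they are obtained
  by cutting off fields that are constant in a chart.\<close>

lemma vector_field_extension: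
  assumes "u \<in> tangent_space A p"
  obtains X where "X \<in> vector_fields A" "X p = u"
proof -
  obtain U x where c: "(U, x) \<in> A" "p \<in> U" by (rule chart_exists)
  obtain a where a: "u = coord_vector A (U, x) p a" using assms tangent_space_eq[OF c] by auto
  obtain \<psi> where \<psi>: "cutoff_chart (U, x) p \<psi>" by (rule cutoff_chart_exists[OF c])
  show ?thesis
    by (rule that[OF cutoff_field_in[OF \<psi>, of a]])
      (use \<psi> in \<open>simp add: a cutoff_field_def cutoff_chart_def\<close>)
qed

text \<open>Let \<open>\<Psi>\<close> be the cut-off function on \<open>M\<close>, let \<open>y b = \<Psi> (b \<bullet> (x - x p))\<close> be the cut-off coordinates
  and let \<open>X \<bullet> b\<close> be the component of \<open>X\<close> along \<open>b\<close> in the chart. The product rule gives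
  \<open>\<Psi> X (y b) - y b X \<Psi> = \<Psi>\<^sup>2 (X \<bullet> b)\<close>. So the components of \<open>\<Psi>\<^sup>3 X\<close> in the global fields \<open>\<Psi> \<partial>\<^sub>b\<close> are
  smooth functions on \<open>M\<close>, and they vanish wherever \<open>X\<close> does.\<close>

definition cutoff_component ::
  "('m, 'n) chart \<Rightarrow> 'm \<Rightarrow> (real^'n \<Rightarrow> real) \<Rightarrow> 'm vector_field \<Rightarrow> real^'n \<Rightarrow> 'm \<Rightarrow> real" where
  "cutoff_component c p \<psi> X b q =
    extend_by_zero (fst c) (snd c) \<psi> q * X q (cutoff_coord c p \<psi> b) -
    cutoff_coord c p \<psi> b q * X q (extend_by_zero (fst c) (snd c) \<psi>)"

lemma cutoff_component_smooth:
  assumes "cutoff_chart (U, x) p \<psi>" "X \<in> vector_fields A"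
  shows "cutoff_component (U, x) p \<psi> X b \<in> smooth_functions A"
  unfolding cutoff_component_def fst_conv snd_conv
  by (rule smooth_functions_diff[OF smooth_functions_mult smooth_functions_mult])
    (rule vector_field_smooth[OF assms(2)] cutoff_coord_smooth[OF assms(1)]
      cutoff_smooth[OF assms(1)])+

lemma cutoff_expansion:
  assumes \<psi>: "cutoff_chart (U, x) p \<psi>" and X: "X \<in> vector_fields A"
  shows "vf_scale (\<lambda>q. extend_by_zero U x \<psi> q ^ 3) X =
    (\<lambda>q f. \<Sum>b\<in>Basis. cutoff_component (U, x) p \<psi> X b q * cutoff_field (U, x) \<psi> b q f)"
proof (intro ext)
  fix q f
  have c: "(U, x) \<in> A" using \<psi> by (simp add: cutoff_chart_def)
  show "vf_scale (\<lambda>q. extend_by_zero U x \<psi> q ^ 3) X q f =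
    (\<Sum>b\<in>Basis. cutoff_component (U, x) p \<psi> X b q * cutoff_field (U, x) \<psi> b q f)"
  proof (cases "q \<in> U")
    case True
    obtain a where a: "X q = coord_vector A (U, x) q a"
      using vector_field_tangent[OF X, of q] tangent_space_eq[OF c True] by auto
    have comp: "cutoff_component (U, x) p \<psi> X b q = \<psi> (x q) ^ 2 * (a \<bullet> b)" for b
      using True by (simp add: cutoff_component_def a coord_vector_cutoff_coord[OF \<psi> True])
        (simp add: cutoff_coord_def extend_by_zero_def algebra_simps power2_eq_square inner_commute)
    have "(\<Sum>b\<in>Basis. cutoff_component (U, x) p \<psi> X b q * cutoff_field (U, x) \<psi> b q f) =
        \<psi> (x q) ^ 3 * (\<Sum>b\<in>Basis. (a \<bullet> b) * coord_vector A (U, x) q b f)"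
      using True by (simp add: comp cutoff_field_def coord_vector_scale[OF c True]
          sum_distrib_left power2_eq_square power3_eq_cube mult_ac)
    also have "(\<Sum>b\<in>Basis. (a \<bullet> b) * coord_vector A (U, x) q b f) = X q f"
      using fun_cong[OF coord_vector_sum[OF c True, of "\<lambda>b. a \<bullet> b" "\<lambda>b. b" Basis], of f]
      by (simp add: euclidean_representation a)
    finally show ?thesis using True by (simp add: vf_scale_def extend_by_zero_def)
  next
    case False
    then show ?thesis by (simp add: vf_scale_def extend_by_zero_def cutoff_field_def)
  qed
qed

lemma connection_sum:
  assumes D: "affine_connection A D" and Y: "Y \<in> vector_fields A"
    and "\<And>i. i \<in> I \<Longrightarrow> k i \<in> smooth_functions A" "\<And>i. i \<in> I \<Longrightarrow> E i \<in> vector_fields A"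
  shows "D (\<lambda>p f. \<Sum>i\<in>I. k i p * E i p f) Y = (\<lambda>p f. \<Sum>i\<in>I. k i p * D (E i) Y p f)"
  using assms(3,4)
proof (induction I rule: infinite_finite_induct)
  case (insert i I)
  have "D (vf_add (vf_scale (k i) (E i)) (\<lambda>p f. \<Sum>i\<in>I. k i p * E i p f)) Y =
      vf_add (vf_scale (k i) (D (E i) Y)) (\<lambda>p f. \<Sum>i\<in>I. k i p * D (E i) Y p f)"
    using D Y insert vf_sum_in[of I k E] vf_scale_in[of "k i" "E i"]
    by (simp add: affine_connection_def)
  then show ?case using insert.hyps by (simp add: vf_add_def vf_scale_def)
next
  case empty
  have "D (vf_scale (\<lambda>p. 0) (\<lambda>p f. 0)) Y = vf_scale (\<lambda>p. 0) (D (\<lambda>p f. 0) Y)"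
    using D Y smooth_functions_const vf_0 by (simp add: affine_connection_def)
  then show ?case by (simp add: vf_scale_def)
next
  case (infinite I)
  have "D (vf_scale (\<lambda>p. 0) (\<lambda>p f. 0)) Y = vf_scale (\<lambda>p. 0) (D (\<lambda>p f. 0) Y)"
    using D Y smooth_functions_const vf_0 by (simp add: affine_connection_def)
  then show ?case using infinite by (simp add: vf_scale_def)
qed

text \<open>A connection is linear over smooth functions in its first argument, so the expansion above
  expresses \<open>\<Psi>\<^sup>3 D\<^sub>X Y\<close> by the components of \<open>\<Psi>\<^sup>3 X\<close>, all of which vanish at \<open>p\<close>; and \<open>\<Psi> p = 1\<close>.\<close>

lemma connection_tensorial:
  assumes D: "affine_connection A D" and X: "X \<in> vector_fields A" and Y: "Y \<in> vector_fields A"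
    and "X p = (\<lambda>f. 0)"
  shows "D X Y p = (\<lambda>f. 0)"
proof
  fix f
  obtain U x where c: "(U, x) \<in> A" "p \<in> U" by (rule chart_exists)
  obtain \<psi> where \<psi>: "cutoff_chart (U, x) p \<psi>" by (rule cutoff_chart_exists[OF c])
  have 1: "extend_by_zero U x \<psi> p = 1"
    using \<psi> by (simp add: extend_by_zero_def cutoff_chart_def)
  have "(\<lambda>q. extend_by_zero U x \<psi> q ^ 3) \<in> smooth_functions A"
    using cutoff_smooth[OF \<psi>] by (simp add: power3_eq_cube smooth_functions_mult)
  then have "D (vf_scale (\<lambda>q. extend_by_zero U x \<psi> q ^ 3) X) Y p f = D X Y p f"
    using D X Y 1 by (simp add: affine_connection_def) (simp add: vf_scale_def)
  moreover have "D (vf_scale (\<lambda>q. extend_by_zero U x \<psi> q ^ 3) X) Y p f =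
      (\<Sum>b\<in>Basis. cutoff_component (U, x) p \<psi> X b p * D (cutoff_field (U, x) \<psi> b) Y p f)"
    unfolding cutoff_expansion[OF \<psi> X]
    by (rule fun_cong[OF fun_cong[OF connection_sum[where I = Basis, OF D Y
            cutoff_component_smooth[OF \<psi> X] cutoff_field_in[OF \<psi>]]]])
  moreover have "cutoff_component (U, x) p \<psi> X b p = 0" for b
    by (simp add: cutoff_component_def assms(4))
  ultimately show "D X Y p f = 0" by simp
qed

end


section \<open>The Hessian\<close>

locale riemannian_levi_civita =
  fixes A :: "('m::t2_space, 'n::finite) chart set" and g :: "'m metric" and D :: "'m connection"
  assumes riemannian: "riemannian_manifold A g" and levi_civita: "levi_civita A g D"

sublocale riemannian_levi_civita \<subseteq> smooth_manifold A
  using riemannian by unfold_locales (simp add: riemannian_manifold_def)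

context riemannian_levi_civita
begin

lemma connection: "affine_connection A D"
  using levi_civita by (simp add: levi_civita_def)

lemma connection_in: "X \<in> vector_fields A \<Longrightarrow> Y \<in> vector_fields A \<Longrightarrow> D X Y \<in> vector_fields A"
  using connection by (simp add: affine_connection_def)

definition second_derivative ::
  "'m vector_field \<Rightarrow> 'm vector_field \<Rightarrow> ('m \<Rightarrow> real) \<Rightarrow> 'm \<Rightarrow> real" where
  "second_derivative X Y f p = X p (\<lambda>q. Y q f) - D X Y p f"

lemma second_derivative_commute:
  assumes "X \<in> vector_fields A" "Y \<in> vector_fields A"
  shows "second_derivative X Y f p = second_derivative Y X f p"
proof -
  have "(\<lambda>p f. D X Y p f - D Y X p f) = lie_bracket X Y"
    using levi_civita assms by (simp add: levi_civita_def)
  then have "D X Y p f - D Y X p f = X p (\<lambda>q. Y q f) - Y p (\<lambda>q. X q f)"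
    by (metis lie_bracket_def)
  then show ?thesis by (simp add: second_derivative_def)
qed

lemma second_derivative_lincomb:
  assumes "X \<in> vector_fields A" "Y \<in> vector_fields A" "Z \<in> vector_fields A"
  shows "second_derivative (vf_add (vf_scale (\<lambda>q. s) X) (vf_scale (\<lambda>q. t) Y)) Z f p =
    s * second_derivative X Z f p + t * second_derivative Y Z f p"
proof -
  have "D (vf_add (vf_scale (\<lambda>q. s) X) (vf_scale (\<lambda>q. t) Y)) Z =
      vf_add (vf_scale (\<lambda>q. s) (D X Z)) (vf_scale (\<lambda>q. t) (D Y Z))"
    using connection assms vf_scale_in[OF smooth_functions_const] smooth_functions_const
    by (simp add: affine_connection_def)
  then show ?thesis
    by (simp add: second_derivative_def) (simp add: vf_add_def vf_scale_def algebra_simps)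
qed

lemma second_derivative_tensorial_left:
  assumes "X \<in> vector_fields A" "X' \<in> vector_fields A" "Y \<in> vector_fields A" "X p = X' p"
  shows "second_derivative X Y f p = second_derivative X' Y f p"
proof -
  let ?Z = "vf_add (vf_scale (\<lambda>q. 1) X) (vf_scale (\<lambda>q. - 1) X')"
  have Z: "?Z \<in> vector_fields A"
    by (intro vf_add_in vf_scale_in smooth_functions_const assms)
  have 0: "?Z p = (\<lambda>f. 0)" using assms(4) by (simp add: vf_add_def vf_scale_def)
  have "second_derivative ?Z Y f p = 0"
    using connection_tensorial[where D = D, OF connection Z assms(3) 0] 0
    by (simp add: second_derivative_def)
  then show ?thesis using second_derivative_lincomb[OF assms(1-3), of 1 "- 1"] by simp
qed

text \<open>The expression \<open>X Y f - (D\<^sub>X Y) f\<close> is tensorial in \<open>X\<close> because a connection is, and symmetric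
  because \<open>D\<close> is torsion free; hence it is tensorial in \<open>Y\<close> as well.\<close>

lemma hessian_vector_fields:
  assumes "X \<in> vector_fields A" "Y \<in> vector_fields A"
  shows "hessian A D f p (X p) (Y p) = second_derivative X Y f p"
  unfolding hessian_def
proof (rule the_equality)
  have tensorial: "second_derivative X Y f p = second_derivative X' Y' f p"
    if "X' \<in> vector_fields A" "Y' \<in> vector_fields A" "X' p = X p" "Y' p = Y p" for X' Y'
  proof -
    have "second_derivative X Y f p = second_derivative X' Y f p"
      using second_derivative_tensorial_left[OF assms(1) that(1) assms(2)] that(3) by simp
    also have "\<dots> = second_derivative Y X' f p"
      by (rule second_derivative_commute[OF that(1) assms(2)])
    also have "\<dots> = second_derivative Y' X' f p"
      using second_derivative_tensorial_left[OF assms(2) that(2,1)] that(4) by simp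
    also have "\<dots> = second_derivative X' Y' f p"
      by (rule second_derivative_commute[OF that(2,1)])
    finally show ?thesis .
  qed
  then show "\<forall>X'\<in>vector_fields A. \<forall>Y'\<in>vector_fields A. X' p = X p \<and> Y' p = Y p \<longrightarrow>
      second_derivative X Y f p = X' p (\<lambda>q. Y' q f) - D X' Y' p f"
    unfolding second_derivative_def[symmetric] by blast
  show "h = second_derivative X Y f p"
    if "\<forall>X'\<in>vector_fields A. \<forall>Y'\<in>vector_fields A. X' p = X p \<and> Y' p = Y p \<longrightarrow>
      h = X' p (\<lambda>q. Y' q f) - D X' Y' p f" for h
    using that assms unfolding second_derivative_def by blast
qed

lemma hessian_commute:
  assumes "u \<in> tangent_space A p" "v \<in> tangent_space A p"
  shows "hessian A D f p u v = hessian A D f p v u"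
proof -
  obtain X where X: "X \<in> vector_fields A" "X p = u"
    by (rule vector_field_extension[OF assms(1)])
  obtain Y where Y: "Y \<in> vector_fields A" "Y p = v"
    by (rule vector_field_extension[OF assms(2)])
  show ?thesis
    using hessian_vector_fields[OF X(1) Y(1), of f p] hessian_vector_fields[OF Y(1) X(1), of f p]
      second_derivative_commute[OF X(1) Y(1)] X(2) Y(2) by simp
qed

lemma hessian_lincomb_left:
  assumes "u \<in> tangent_space A p" "v \<in> tangent_space A p" "w \<in> tangent_space A p"
  shows "hessian A D f p (\<lambda>f. s * u f + t * v f) w =
    s * hessian A D f p u w + t * hessian A D f p v w"
proof -
  obtain X where X: "X \<in> vector_fields A" "X p = u"
    by (rule vector_field_extension[OF assms(1)])
  obtain Y where Y: "Y \<in> vector_fields A" "Y p = v"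
    by (rule vector_field_extension[OF assms(2)])
  obtain Z where Z: "Z \<in> vector_fields A" "Z p = w"
    by (rule vector_field_extension[OF assms(3)])
  let ?W = "vf_add (vf_scale (\<lambda>q. s) X) (vf_scale (\<lambda>q. t) Y)"
  have W: "?W \<in> vector_fields A"
    by (intro vf_add_in vf_scale_in smooth_functions_const X Y)
  have Wp: "?W p = (\<lambda>f. s * u f + t * v f)"
    using X(2) Y(2) by (simp add: vf_add_def vf_scale_def)
  show ?thesis
    using hessian_vector_fields[OF W Z(1), of f p] hessian_vector_fields[OF X(1) Z(1), of f p]
      hessian_vector_fields[OF Y(1) Z(1), of f p] second_derivative_lincomb[OF X(1) Y(1) Z(1)]
    unfolding Wp X(2) Y(2) Z(2) by simp
qed

lemma hessian_add:
  assumes "u \<in> tangent_space A p" "v \<in> tangent_space A p"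
    and "f \<in> smooth_functions A" "h \<in> smooth_functions A"
  shows "hessian A D (\<lambda>q. f q + h q) p u v = hessian A D f p u v + hessian A D h p u v"
proof -
  obtain X where X: "X \<in> vector_fields A" "X p = u"
    by (rule vector_field_extension[OF assms(1)])
  obtain Y where Y: "Y \<in> vector_fields A" "Y p = v"
    by (rule vector_field_extension[OF assms(2)])
  note DXY = connection_in[OF X(1) Y(1)]
  have "X p (\<lambda>q. Y q f + Y q h) = X p (\<lambda>q. Y q f) + X p (\<lambda>q. Y q h)"
    by (rule tangent_add[OF vector_field_tangent[OF X(1)]
          vector_field_smooth[OF Y(1) assms(3)] vector_field_smooth[OF Y(1) assms(4)]])
  then have "second_derivative X Y (\<lambda>q. f q + h q) p =
      second_derivative X Y f p + second_derivative X Y h p"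
    using X(1) Y(1) DXY assms(3,4)
    by (simp add: second_derivative_def tangent_add[OF vector_field_tangent])
  then show ?thesis
    using hessian_vector_fields[OF X(1) Y(1)] unfolding X(2)[symmetric] Y(2)[symmetric] by simp
qed

text \<open>At a common zero of \<open>f\<close> and \<open>h\<close> only \<open>df \<otimes> dh + dh \<otimes> df\<close> remains, so products of such functions
  have a Hessian that is known from first derivatives.\<close>

lemma hessian_mult:
  assumes "u \<in> tangent_space A p" "v \<in> tangent_space A p"
    and "f \<in> smooth_functions A" "h \<in> smooth_functions A"
  shows "hessian A D (\<lambda>q. f q * h q) p u v =
    f p * hessian A D h p u v + h p * hessian A D f p u v + u f * v h + u h * v f"
proof -
  obtain X where X: "X \<in> vector_fields A" "X p = u"
    by (rule vector_field_extension[OF assms(1)])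
  obtain Y where Y: "Y \<in> vector_fields A" "Y p = v"
    by (rule vector_field_extension[OF assms(2)])
  note DXY = connection_in[OF X(1) Y(1)]
  note Yf = vector_field_smooth[OF Y(1) assms(3)] and Yh = vector_field_smooth[OF Y(1) assms(4)]
  have "X p (\<lambda>q. f q * Y q h + h q * Y q f) =
      (f p * X p (\<lambda>q. Y q h) + Y p h * X p f) + (h p * X p (\<lambda>q. Y q f) + Y p f * X p h)"
    unfolding tangent_mult[OF vector_field_tangent[OF X(1)] assms(3) Yh, symmetric]
      tangent_mult[OF vector_field_tangent[OF X(1)] assms(4) Yf, symmetric]
    by (rule tangent_add[OF vector_field_tangent[OF X(1)] smooth_functions_mult[OF assms(3) Yh]
          smooth_functions_mult[OF assms(4) Yf]])
  then have "second_derivative X Y (\<lambda>q. f q * h q) p =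
      f p * second_derivative X Y h p + h p * second_derivative X Y f p
      + X p f * Y p h + X p h * Y p f"
    using X(1) Y(1) DXY assms(3,4) Yf Yh
    by (simp add: second_derivative_def tangent_mult[OF vector_field_tangent] algebra_simps)
  then show ?thesis
    using hessian_vector_fields[OF X(1) Y(1)] unfolding X(2)[symmetric] Y(2)[symmetric] by simp
qed

lemma hessian_const:
  assumes "u \<in> tangent_space A p" "v \<in> tangent_space A p"
  shows "hessian A D (\<lambda>q. k) p u v = 0"
proof -
  obtain X where X: "X \<in> vector_fields A" "X p = u"
    by (rule vector_field_extension[OF assms(1)])
  obtain Y where Y: "Y \<in> vector_fields A" "Y p = v"
    by (rule vector_field_extension[OF assms(2)])
  have "second_derivative X Y (\<lambda>q. k) p = 0"
    using X(1) Y(1) connection_in[OF X(1) Y(1)]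
    by (simp add: second_derivative_def tangent_const[OF vector_field_tangent])
  then show ?thesis
    using hessian_vector_fields[OF X(1) Y(1)] unfolding X(2)[symmetric] Y(2)[symmetric] by simp
qed

lemma hessian_cmult:
  assumes "u \<in> tangent_space A p" "v \<in> tangent_space A p" "f \<in> smooth_functions A"
  shows "hessian A D (\<lambda>q. k * f q) p u v = k * hessian A D f p u v"
  using hessian_mult[OF assms(1,2) smooth_functions_const assms(3), of k] hessian_const[OF assms(1,2)]
    tangent_const[OF assms(1)] tangent_const[OF assms(2)] by simp

lemma hessian_sum:
  assumes "u \<in> tangent_space A p" "v \<in> tangent_space A p"
    and "\<And>i. i \<in> I \<Longrightarrow> f i \<in> smooth_functions A"
  shows "hessian A D (\<lambda>q. \<Sum>i\<in>I. f i q) p u v = (\<Sum>i\<in>I. hessian A D (f i) p u v)"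
  using assms(3)
proof (induction I rule: infinite_finite_induct)
  case (insert i I)
  then show ?case
    using hessian_add[OF assms(1,2) _ smooth_functions_sum, of "f i" I f] by simp
qed (simp_all add: hessian_const[OF assms(1,2)])

end


section \<open>Orthonormal bases and metric traces\<close>

lemma bilinear_lsum:
  fixes b :: "'a::real_vector \<Rightarrow> 'a \<Rightarrow> real"
  assumes "bilinear b"
  shows "b (\<Sum>i\<in>I. s i *\<^sub>R v i) w = (\<Sum>i\<in>I. s i * b (v i) w)"
proof -
  have lin: "linear (\<lambda>u. b u w)" using assms by (simp add: bilinear_def)
  show ?thesis by (simp add: linear_sum[OF lin] linear_cmul[OF lin])
qed

text \<open>Gram--Schmidt for an arbitrary inner product on \<open>\<real>\<^sup>n\<close>: a family that is orthonormal on a proper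
  subset \<open>I\<close> of the indices spans a proper subspace, and the component of an outside vector orthogonal
  to it serves for one more index.\<close>

lemma orthonormal_basis_exists_form:
  fixes b :: "real^'n \<Rightarrow> real^'n \<Rightarrow> real"
  assumes b: "bilinear b" and sym: "\<And>v w. b v w = b w v" and pos: "\<And>v. v \<noteq> 0 \<Longrightarrow> b v v > 0"
  obtains e :: "'n \<Rightarrow> real^'n" where "\<And>i j. b (e i) (e j) = (if i = j then 1 else 0)"
proof -
  have "\<exists>e. \<forall>i\<in>I. \<forall>j\<in>I. b (e i) (e j) = (if i = j then 1 else 0)" if "finite I" for I :: "'n set"
    using that
  proof (induction I rule: finite_induct)
    case (insert k I)
    then obtain e where e: "\<forall>i\<in>I. \<forall>j\<in>I. b (e i) (e j) = (if i = j then 1 else 0)" by blast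
    have "card (insert k I) \<le> CARD('n)" by (intro card_mono) auto
    then have "card I < CARD('n)" using insert.hyps by simp
    moreover have "dim (e ` I) \<le> card I"
      using dim_le_card'[OF finite_imageI] card_image_le insert.hyps(1) le_trans by blast
    ultimately have "span (e ` I) \<noteq> UNIV"
      using dim_span[of "e ` I"] by (metis dim_UNIV DIM_cart DIM_real mult.right_neutral leD)
    then obtain v where v: "v \<notin> span (e ` I)" by blast
    define w where "w = v - (\<Sum>i\<in>I. b v (e i) *\<^sub>R e i)"
    have "(\<Sum>i\<in>I. b v (e i) *\<^sub>R e i) \<in> span (e ` I)"
      by (intro span_sum span_scale span_base) auto
    then have "w \<noteq> 0" using v by (auto simp: w_def)
    then have ww: "b w w > 0" by (rule pos)
    have wj: "b w (e j) = 0" if "j \<in> I" for j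
    proof -
      have "b (\<Sum>i\<in>I. b v (e i) *\<^sub>R e i) (e j) = (\<Sum>i\<in>I. b v (e i) * b (e i) (e j))"
        by (rule bilinear_lsum[OF b])
      also have "\<dots> = (\<Sum>i\<in>I. if i = j then b v (e j) else 0)"
        using e that by (intro sum.cong) auto
      also have "\<dots> = b v (e j)" using insert.hyps(1) that by simp
      finally show ?thesis by (simp add: w_def bilinear_lsub[OF b])
    qed
    define e' where "e' = e(k := (1 / sqrt (b w w)) *\<^sub>R w)"
    have "b (e' i) (e' j) = (if i = j then 1 else 0)" if "i \<in> insert k I" "j \<in> insert k I" for i j
      using that e wj sym insert.hyps(2) ww
      by (auto simp: e'_def bilinear_lmul[OF b] bilinear_rmul[OF b] field_simps
          real_sqrt_mult[symmetric])
    then show ?case by blast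
  qed simp
  from this[of UNIV] show ?thesis using that by auto
qed

text \<open>Taking coefficients is a left inverse of forming linear combinations of the \<open>e i\<close>. Both maps are
  endomorphisms of the finite-dimensional space \<open>\<real>\<^sup>n\<close>, so it is also a right inverse.\<close>

lemma orthonormal_expansion_form:
  fixes b :: "real^'n \<Rightarrow> real^'n \<Rightarrow> real" and e :: "'n \<Rightarrow> real^'n"
  assumes b: "bilinear b" and e: "\<And>i j. b (e i) (e j) = (if i = j then 1 else 0)"
  shows "(\<Sum>i\<in>UNIV. b v (e i) *\<^sub>R e i) = v"
proof -
  define S where "S = (\<lambda>c::real^'n. \<Sum>i\<in>UNIV. (c $ i) *\<^sub>R e i)"
  define T where "T = (\<lambda>v. \<chi> i. b v (e i))"
  have "linear S"
    unfolding S_def by (intro linearI) (simp_all add: scaleR_left_distrib sum.distrib scaleR_sum_right)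
  moreover have "linear T"
    unfolding T_def
    by (intro linearI) (simp_all add: vec_eq_iff bilinear_ladd[OF b] bilinear_lmul[OF b])
  moreover have "T \<circ> S = id"
  proof
    fix c
    have "b (S c) (e j) = c $ j" for j
      by (simp add: S_def bilinear_lsum[OF b] e if_distrib cong: if_cong)
    then show "(T \<circ> S) c = id c" by (simp add: T_def vec_eq_iff)
  qed
  ultimately have "S \<circ> T = id" using linear_inverse_left by metis
  then have "S (T v) = v" by (metis comp_apply id_apply)
  then show ?thesis by (simp add: S_def T_def)
qed

context riemannian_levi_civita
begin

lemma metric: "riemannian_metric A g"
  using riemannian by (simp add: riemannian_manifold_def)

lemma metric_commute:
  "u \<in> tangent_space A p \<Longrightarrow> v \<in> tangent_space A p \<Longrightarrow> g p u v = g p v u"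
  using metric by (simp add: riemannian_metric_def)

lemma metric_pos: "u \<in> tangent_space A p \<Longrightarrow> u \<noteq> (\<lambda>f. 0) \<Longrightarrow> g p u u > 0"
  using metric by (simp add: riemannian_metric_def)

text \<open>A tangent vector is an arbitrary functional as far as its type is concerned, so linearity can
  only be asked for on the tangent space.\<close>

definition linear_at :: "'m \<Rightarrow> ('m tangent \<Rightarrow> real) \<Rightarrow> bool" where
  "linear_at p \<alpha> \<longleftrightarrow> (\<forall>u\<in>tangent_space A p. \<forall>v\<in>tangent_space A p. \<forall>s t.
     \<alpha> (\<lambda>f. s * u f + t * v f) = s * \<alpha> u + t * \<alpha> v)"

definition bilinear_at :: "'m \<Rightarrow> ('m tangent \<Rightarrow> 'm tangent \<Rightarrow> real) \<Rightarrow> bool" where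
  "bilinear_at p B \<longleftrightarrow>
     (\<forall>w\<in>tangent_space A p. linear_at p (B w) \<and> linear_at p (\<lambda>u. B u w))"

lemma linear_atD:
  "linear_at p \<alpha> \<Longrightarrow> u \<in> tangent_space A p \<Longrightarrow> v \<in> tangent_space A p \<Longrightarrow>
    \<alpha> (\<lambda>f. s * u f + t * v f) = s * \<alpha> u + t * \<alpha> v"
  unfolding linear_at_def by simp

lemma linear_at_sum:
  assumes \<alpha>: "linear_at p \<alpha>" and u: "\<And>i. i \<in> I \<Longrightarrow> u i \<in> tangent_space A p"
  shows "\<alpha> (\<lambda>f. \<Sum>i\<in>I. s i * u i f) = (\<Sum>i\<in>I. s i * \<alpha> (u i))"
proof -
  have 0: "\<alpha> (\<lambda>f. 0) = 0"
    using linear_atD[OF \<alpha> tangent_0 tangent_0, of 0 0] by simp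
  show ?thesis
    using u
  proof (induction I rule: infinite_finite_induct)
    case (insert i I)
    have "\<alpha> (\<lambda>f. s i * u i f + 1 * (\<Sum>i\<in>I. s i * u i f)) =
        s i * \<alpha> (u i) + 1 * \<alpha> (\<lambda>f. \<Sum>i\<in>I. s i * u i f)"
      using insert.prems by (intro linear_atD[OF \<alpha>] tangent_sum) auto
    then show ?case using insert by simp
  qed (simp_all add: 0)
qed

lemma linear_at_cong:
  assumes "\<And>u. u \<in> tangent_space A p \<Longrightarrow> \<alpha> u = \<alpha>' u"
  shows "linear_at p \<alpha> = linear_at p \<alpha>'"
  unfolding linear_at_def using assms tangent_lincomb by simp

lemma bilinear_at_cong:
  assumes "\<And>u v. u \<in> tangent_space A p \<Longrightarrow> v \<in> tangent_space A p \<Longrightarrow> B u v = B' u v"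
  shows "bilinear_at p B = bilinear_at p B'"
proof -
  have "linear_at p (B w) = linear_at p (B' w)" "linear_at p (\<lambda>u. B u w) = linear_at p (\<lambda>u. B' u w)"
    if "w \<in> tangent_space A p" for w
    using that assms by (auto intro!: linear_at_cong)
  then show ?thesis unfolding bilinear_at_def by simp
qed

lemma linear_at_cmult: "linear_at p \<alpha> \<Longrightarrow> linear_at p (\<lambda>u. k * \<alpha> u)"
  unfolding linear_at_def by (simp add: algebra_simps)

lemma linear_at_sum_functions:
  "(\<And>i. i \<in> I \<Longrightarrow> linear_at p (\<alpha> i)) \<Longrightarrow> linear_at p (\<lambda>u. \<Sum>i\<in>I. \<alpha> i u)"
  unfolding linear_at_def by (simp add: sum.distrib sum_distrib_left)

lemma bilinear_at_mult:
  assumes "linear_at p \<alpha>" "linear_at p \<beta>"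
  shows "bilinear_at p (\<lambda>u v. \<alpha> u * \<beta> v)"
proof -
  have "linear_at p (\<lambda>u. \<alpha> u * \<beta> w)" for w
    using linear_at_cmult[OF assms(1), of "\<beta> w"] by (simp add: mult.commute)
  then show ?thesis
    using linear_at_cmult[OF assms(2)] by (simp add: bilinear_at_def)
qed

lemma bilinear_at_sum:
  "(\<And>i. i \<in> I \<Longrightarrow> bilinear_at p (B i)) \<Longrightarrow> bilinear_at p (\<lambda>u v. \<Sum>i\<in>I. B i u v)"
  unfolding bilinear_at_def by (simp add: linear_at_sum_functions)

lemma bilinear_at_left: "bilinear_at p B \<Longrightarrow> w \<in> tangent_space A p \<Longrightarrow> linear_at p (\<lambda>u. B u w)"
  and bilinear_at_right: "bilinear_at p B \<Longrightarrow> w \<in> tangent_space A p \<Longrightarrow> linear_at p (B w)"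
  unfolding bilinear_at_def by auto

lemma bilinear_at_metric: "bilinear_at p (g p)"
proof -
  have 1: "linear_at p (\<lambda>u. g p u w)" if "w \<in> tangent_space A p" for w
    using metric that by (simp add: riemannian_metric_def linear_at_def)
  moreover have "linear_at p (g p w)" if "w \<in> tangent_space A p" for w
    using 1[OF that] linear_at_cong[of p "g p w" "\<lambda>u. g p u w"] metric_commute that by simp
  ultimately show ?thesis by (simp add: bilinear_at_def)
qed

lemma bilinear_at_hessian: "bilinear_at p (hessian A D f p)"
proof -
  have 1: "linear_at p (\<lambda>u. hessian A D f p u w)" if "w \<in> tangent_space A p" for w
    using hessian_lincomb_left that by (simp add: linear_at_def)
  moreover have "linear_at p (hessian A D f p w)" if "w \<in> tangent_space A p" for w
    using 1[OF that] linear_at_cong[of p "hessian A D f p w" "\<lambda>u. hessian A D f p u w"]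
      hessian_commute that by simp
  ultimately show ?thesis by (simp add: bilinear_at_def)
qed

lemma bilinear_coord:
  assumes c: "(U, x) \<in> A" "p \<in> U"
  shows "bilinear (\<lambda>v w. g p (coord_vector A (U, x) p v) (coord_vector A (U, x) p w))"
proof -
  have lin: "linear (\<lambda>v. \<alpha> (coord_vector A (U, x) p v))" if "linear_at p \<alpha>" for \<alpha>
  proof (rule linearI)
    have *: "\<alpha> (coord_vector A (U, x) p (s *\<^sub>R v + t *\<^sub>R w)) =
        s * \<alpha> (coord_vector A (U, x) p v) + t * \<alpha> (coord_vector A (U, x) p w)" for s t v w
      unfolding coord_vector_lincomb[OF c] by (intro linear_atD[OF that] tangent_coord c)
    show "\<alpha> (coord_vector A (U, x) p (v + w)) =
        \<alpha> (coord_vector A (U, x) p v) + \<alpha> (coord_vector A (U, x) p w)" for v w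
      using *[of 1 v 1 w] by simp
    show "\<alpha> (coord_vector A (U, x) p (s *\<^sub>R v)) = s *\<^sub>R \<alpha> (coord_vector A (U, x) p v)" for s v
      using *[of s v 0 v] by simp
  qed
  show ?thesis
    unfolding bilinear_def
    using lin[OF bilinear_at_left[OF bilinear_at_metric tangent_coord[OF c]]]
      lin[OF bilinear_at_right[OF bilinear_at_metric tangent_coord[OF c]]] by simp
qed

lemma orthonormal_basis_exists: obtains e where "orthonormal_basis A g p e"
proof -
  obtain U x where c: "(U, x) \<in> A" "p \<in> U" by (rule chart_exists)
  let ?t = "coord_vector A (U, x) p"
  note T = tangent_coord[OF c]
  have "g p (?t v) (?t v) > 0" if "v \<noteq> 0" for v
  proof (rule metric_pos[OF T])
    show "?t v \<noteq> (\<lambda>f. 0)"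
      using inj_eq[OF coord_vector_inj[OF c], of v 0] that by (simp add: coord_vector_0[OF c])
  qed
  then obtain e :: "'n \<Rightarrow> real^'n"
    where "\<And>i j. g p (?t (e i)) (?t (e j)) = (if i = j then 1 else 0)"
    using orthonormal_basis_exists_form[OF bilinear_coord[OF c] metric_commute[OF T T]] by blast
  then have "orthonormal_basis A g p (\<lambda>i. ?t (e i))"
    by (simp add: orthonormal_basis_def T)
  then show ?thesis by (rule that)
qed

lemma orthonormal_basisD:
  assumes "orthonormal_basis A g p e"
  shows "e i \<in> tangent_space A p" "g p (e i) (e j) = (if i = j then 1 else 0)"
  using assms by (simp_all add: orthonormal_basis_def)

lemma orthonormal_expansion:
  assumes e: "orthonormal_basis A g p e" and u: "u \<in> tangent_space A p"
  shows "u = (\<lambda>f. \<Sum>i\<in>UNIV. g p u (e i) * e i f)"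
proof -
  obtain U x where c: "(U, x) \<in> A" "p \<in> U" by (rule chart_exists)
  let ?t = "coord_vector A (U, x) p"
  obtain a where a: "u = ?t a" using u tangent_space_eq[OF c] by auto
  have "\<forall>i. \<exists>v. e i = ?t v" using orthonormal_basisD(1)[OF e] tangent_space_eq[OF c] by auto
  then obtain v where v: "e i = ?t (v i)" for i by metis
  have "(\<Sum>i\<in>UNIV. g p (?t a) (?t (v i)) *\<^sub>R v i) = a"
    using orthonormal_basisD(2)[OF e]
    by (intro orthonormal_expansion_form[OF bilinear_coord[OF c]]) (simp add: v)
  then show ?thesis
    using coord_vector_sum[OF c, of "\<lambda>i. g p (?t a) (?t (v i))" v UNIV] by (simp add: a v)
qed

text \<open>With \<open>O i j = g (e' i) (e j)\<close>, expand one argument of \<open>B (e' i) (e' i)\<close> in the basis \<open>e\<close>, and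
  recombine the other by \<open>\<Sum>i. O i j e' i = e j\<close>, which is the expansion of \<open>e j\<close> in \<open>e'\<close>.\<close>

lemma trace_basis_independent:
  assumes e: "orthonormal_basis A g p e" and e': "orthonormal_basis A g p e'"
    and B: "bilinear_at p B"
  shows "(\<Sum>i\<in>UNIV. B (e' i) (e' i)) = (\<Sum>i\<in>UNIV. B (e i) (e i))"
proof -
  note T = orthonormal_basisD(1)[OF e] and T' = orthonormal_basisD(1)[OF e']
  have "B (e' i) (e' i) = (\<Sum>j\<in>UNIV. g p (e' i) (e j) * B (e j) (e' i))" for i
    using linear_at_sum[OF bilinear_at_left[OF B T'[of i]], of UNIV e "\<lambda>j. g p (e' i) (e j)"] T
      orthonormal_expansion[OF e T'[of i]] by simp
  then have "(\<Sum>i\<in>UNIV. B (e' i) (e' i)) =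
      (\<Sum>i\<in>UNIV. \<Sum>j\<in>UNIV. g p (e' i) (e j) * B (e j) (e' i))"
    by (rule sum.cong[OF refl])
  also have "\<dots> = (\<Sum>j\<in>UNIV. \<Sum>i\<in>UNIV. g p (e' i) (e j) * B (e j) (e' i))"
    by (rule sum.swap)
  also have "\<dots> = (\<Sum>j\<in>UNIV. B (e j) (e j))"
  proof (rule sum.cong)
    fix j
    show "(\<Sum>i\<in>UNIV. g p (e' i) (e j) * B (e j) (e' i)) = B (e j) (e j)"
      using linear_at_sum[OF bilinear_at_right[OF B T[of j]], of UNIV e' "\<lambda>i. g p (e j) (e' i)"] T'
        orthonormal_expansion[OF e' T[of j]] metric_commute[OF T[of j] T'] by simp
  qed simp
  finally show ?thesis .
qed

lemma metric_trace_eq: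
  assumes e: "orthonormal_basis A g p e" and B: "bilinear_at p B"
  shows "metric_trace A g p B = (\<Sum>i\<in>UNIV. B (e i) (e i))"
  unfolding metric_trace_def Let_def
  by (rule trace_basis_independent[OF e someI[of "orthonormal_basis A g p", OF e] B])

text \<open>By the expansion in the basis, pairing \<open>\<Sum>i. (e i f) e i\<close> with \<open>u\<close> gives \<open>u f\<close>; a second vector
  with this property would differ from it by a vector orthogonal to everything, itself included.\<close>

lemma gradient_eq:
  assumes e: "orthonormal_basis A g p e"
  shows "gradient A g f p = (\<lambda>h. \<Sum>i\<in>UNIV. e i f * e i h)"
  unfolding gradient_def
proof (rule the_equality)
  let ?v = "\<lambda>h. \<Sum>i\<in>UNIV. e i f * e i h"
  note T = orthonormal_basisD(1)[OF e]
  have v: "?v \<in> tangent_space A p" by (rule tangent_sum[OF T])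
  have vu: "g p ?v u = u f" if u: "u \<in> tangent_space A p" for u
  proof -
    have "g p ?v u = (\<Sum>i\<in>UNIV. e i f * g p (e i) u)"
      by (rule linear_at_sum[OF bilinear_at_left[OF bilinear_at_metric u] T])
    also have "\<dots> = (\<Sum>i\<in>UNIV. g p u (e i) * e i f)"
      using metric_commute[OF u T] by (simp add: mult.commute)
    also have "\<dots> = u f" using fun_cong[OF orthonormal_expansion[OF e u], of f] by simp
    finally show ?thesis .
  qed
  show "?v \<in> tangent_space A p \<and> (\<forall>u\<in>tangent_space A p. g p ?v u = u f)"
    using v vu by blast
  show "w = ?v" if w: "w \<in> tangent_space A p \<and> (\<forall>u\<in>tangent_space A p. g p w u = u f)" for w
  proof -
    let ?d = "\<lambda>h. 1 * w h + (- 1) * ?v h"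
    have d: "?d \<in> tangent_space A p" using tangent_lincomb[OF _ v] w by blast
    have "g p ?d ?d = 1 * g p w ?d + (- 1) * g p ?v ?d"
      using w by (intro linear_atD[OF bilinear_at_left[OF bilinear_at_metric d] _ v]) simp
    then have "g p ?d ?d = 0" using w vu[OF d] d by simp
    then have "?d = (\<lambda>f. 0)" using metric_pos[OF d] by fastforce
    then show ?thesis by (simp add: fun_eq_iff)
  qed
qed


end


section \<open>The operators in an orthonormal basis\<close>

text \<open>In a basis that diagonalises a symmetric \<open>H\<close>, with eigenvalues \<open>l i\<close>, this is
  \<open>2 \<Sum>i. (G i)\<^sup>2 e\<^sub>2(l without l i)\<close>, where \<open>e\<^sub>2\<close> is the second elementary symmetric polynomial.\<close>

definition P_frame :: "('n::finite \<Rightarrow> real) \<Rightarrow> ('n \<Rightarrow> 'n \<Rightarrow> real) \<Rightarrow> real" where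
  "P_frame G H =
     (\<Sum>i\<in>UNIV. (G i)\<^sup>2) * (\<Sum>i\<in>UNIV. H i i)\<^sup>2
     - (\<Sum>i\<in>UNIV. (G i)\<^sup>2) * (\<Sum>i\<in>UNIV. \<Sum>j\<in>UNIV. (H i j)\<^sup>2)
     + 2 * (\<Sum>j\<in>UNIV. (\<Sum>i\<in>UNIV. G i * H i j)\<^sup>2)
     - 2 * (\<Sum>i\<in>UNIV. H i i) * (\<Sum>i\<in>UNIV. G i * (\<Sum>j\<in>UNIV. G j * H i j))"

text \<open>For symmetric \<open>H\<close> this is \<open>6 e\<^sub>3\<close> of the eigenvalues, by Newton's identity.\<close>

definition Q_frame :: "('n::finite \<Rightarrow> 'n \<Rightarrow> real) \<Rightarrow> real" where
  "Q_frame H =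
     (\<Sum>i\<in>UNIV. H i i) ^ 3
     - 3 * (\<Sum>i\<in>UNIV. H i i) * (\<Sum>i\<in>UNIV. \<Sum>j\<in>UNIV. (H i j)\<^sup>2)
     + 2 * (\<Sum>i\<in>UNIV. \<Sum>j\<in>UNIV. \<Sum>k\<in>UNIV. H i j * H i k * H j k)"

context riemannian_levi_civita
begin

lemma laplacian_eq:
  assumes "orthonormal_basis A g p e"
  shows "laplacian A g D f p = (\<Sum>i\<in>UNIV. hessian A D f p (e i) (e i))"
  unfolding laplacian_def by (rule metric_trace_eq[OF assms bilinear_at_hessian])

lemma covector_norm_eq:
  assumes "orthonormal_basis A g p e" "linear_at p \<alpha>"
  shows "(covector_norm A g p \<alpha>)\<^sup>2 = (\<Sum>i\<in>UNIV. (\<alpha> (e i))\<^sup>2)"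
  unfolding covector_norm_def metric_trace_eq[OF assms(1) bilinear_at_mult[OF assms(2,2)]]
  by (simp add: power2_eq_square sum_nonneg)

lemma tensor2_norm_eq:
  assumes e: "orthonormal_basis A g p e" and B: "bilinear_at p B"
  shows "(tensor2_norm A g p B)\<^sup>2 = (\<Sum>i\<in>UNIV. \<Sum>j\<in>UNIV. (B (e i) (e j))\<^sup>2)"
proof -
  note T = orthonormal_basisD(1)[OF e]
  let ?N = "\<lambda>u u'. metric_trace A g p (\<lambda>v v'. B u v * B u' v')"
  have inner: "?N u u' = (\<Sum>j\<in>UNIV. B u (e j) * B u' (e j))"
    if "u \<in> tangent_space A p" "u' \<in> tangent_space A p" for u u'
    by (rule metric_trace_eq[OF e bilinear_at_mult[OF bilinear_at_right[OF B that(1)]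
            bilinear_at_right[OF B that(2)]]])
  have "bilinear_at p (\<lambda>u u'. \<Sum>j\<in>UNIV. B u (e j) * B u' (e j))"
    by (rule bilinear_at_sum[OF bilinear_at_mult[OF bilinear_at_left[OF B T] bilinear_at_left[OF B T]]])
  then have "bilinear_at p ?N"
    by (subst bilinear_at_cong[OF inner])
  from metric_trace_eq[OF e this] show ?thesis
    unfolding tensor2_norm_def by (simp add: inner T power2_eq_square sum_nonneg)
qed

lemma vector_norm_gradient_eq:
  assumes e: "orthonormal_basis A g p e"
  shows "(vector_norm g p (gradient A g f p))\<^sup>2 = (\<Sum>i\<in>UNIV. (e i f)\<^sup>2)"
proof -
  note T = orthonormal_basisD(1)[OF e]
  let ?v = "\<lambda>h. \<Sum>i\<in>UNIV. e i f * e i h"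
  have v: "?v \<in> tangent_space A p" by (rule tangent_sum[OF T])
  have "g p (e i) ?v = (\<Sum>j\<in>UNIV. e j f * g p (e i) (e j))" for i
    by (rule linear_at_sum[OF bilinear_at_right[OF bilinear_at_metric T] T])
  then have "g p (e i) ?v = e i f" for i
    by (simp add: orthonormal_basisD(2)[OF e] if_distrib cong: if_cong)
  moreover have "g p ?v ?v = (\<Sum>i\<in>UNIV. e i f * g p (e i) ?v)"
    by (rule linear_at_sum[OF bilinear_at_left[OF bilinear_at_metric v] T])
  ultimately show ?thesis
    unfolding vector_norm_def gradient_eq[OF e] by (simp add: power2_eq_square sum_nonneg)
qed

lemma P_op_frame:
  assumes e: "orthonormal_basis A g p e"
  shows "P_op A g D \<beta> f p =
    f p ^ \<beta> * P_frame (\<lambda>i. e i f) (\<lambda>i j. hessian A D f p (e i) (e j))"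
proof -
  note T = orthonormal_basisD(1)[OF e]
  let ?G = "gradient A g f p" and ?H = "hessian A D f p"
  have G: "?G \<in> tangent_space A p"
    unfolding gradient_eq[OF e] by (rule tangent_sum[OF T])
  have HG: "?H ?G v = (\<Sum>i\<in>UNIV. e i f * ?H (e i) v)" if "v \<in> tangent_space A p" for v
    unfolding gradient_eq[OF e]
    by (rule linear_at_sum[OF bilinear_at_left[OF bilinear_at_hessian that] T])
  have HG': "?H v ?G = (\<Sum>i\<in>UNIV. e i f * ?H v (e i))" if "v \<in> tangent_space A p" for v
    unfolding gradient_eq[OF e]
    by (rule linear_at_sum[OF bilinear_at_right[OF bilinear_at_hessian that] T])
  have "linear_at p (\<lambda>v. ?H ?G v)"
    by (rule bilinear_at_right[OF bilinear_at_hessian G])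
  from covector_norm_eq[OF e this]
  have "(covector_norm A g p (\<lambda>v. ?H ?G v))\<^sup>2 = (\<Sum>j\<in>UNIV. (\<Sum>i\<in>UNIV. e i f * ?H (e i) (e j))\<^sup>2)"
    by (simp add: HG T)
  moreover have "?H ?G ?G = (\<Sum>i\<in>UNIV. e i f * (\<Sum>j\<in>UNIV. e j f * ?H (e i) (e j)))"
    by (simp add: HG[OF G] HG'[OF T])
  ultimately show ?thesis
    unfolding P_op_def Let_def P_frame_def
    by (simp add: laplacian_eq[OF e] tensor2_norm_eq[OF e bilinear_at_hessian]
        vector_norm_gradient_eq[OF e])
qed

text \<open>The three nested traces are evaluated from the inside out: each is the trace of a form that is
  bilinear as soon as the arguments of the outer traces are tangent vectors.\<close>

lemma Q_op_frame:
  assumes e: "orthonormal_basis A g p e"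
  shows "Q_op A g D \<beta> f p = f p ^ \<beta> * Q_frame (\<lambda>i j. hessian A D f p (e i) (e j))"
proof -
  note T = orthonormal_basisD(1)[OF e]
  let ?T = "tangent_space A p"
  let ?H = "hessian A D f p"
  note left = bilinear_at_left[OF bilinear_at_hessian]
    and right = bilinear_at_right[OF bilinear_at_hessian]
  let ?N = "\<lambda>u u' v v'. metric_trace A g p (\<lambda>w w'. ?H u v * ?H u' w * ?H v' w')"
  let ?M = "\<lambda>u u'. metric_trace A g p (\<lambda>v v'. ?N u u' v v')"
  have N: "?N u u' v v' = (\<Sum>k\<in>UNIV. ?H u v * ?H u' (e k) * ?H v' (e k))"
    if "u' \<in> ?T" "v' \<in> ?T" for u u' v v'
    by (rule metric_trace_eq[OF e bilinear_at_mult[OF linear_at_cmult[OF right[OF that(1)]]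
            right[OF that(2)]]])
  have M: "?M u u' = (\<Sum>j\<in>UNIV. \<Sum>k\<in>UNIV. ?H u (e j) * ?H u' (e k) * ?H (e j) (e k))"
    if "u \<in> ?T" "u' \<in> ?T" for u u'
  proof -
    have "bilinear_at p (\<lambda>v v'. \<Sum>k\<in>UNIV. (?H u' (e k) * ?H u v) * ?H v' (e k))"
      by (rule bilinear_at_sum[OF bilinear_at_mult[OF linear_at_cmult[OF right[OF that(1)]] left[OF T]]])
    then have "bilinear_at p (?N u u')"
      by (subst bilinear_at_cong[OF N[OF that(2)]]) (simp_all add: mult.commute)
    from metric_trace_eq[OF e this] show ?thesis by (simp add: N that T)
  qed
  have "bilinear_at p
      (\<lambda>u u'. \<Sum>j\<in>UNIV. \<Sum>k\<in>UNIV. (?H (e j) (e k) * ?H u (e j)) * ?H u' (e k))"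
    by (rule bilinear_at_sum, rule bilinear_at_sum)
      (rule bilinear_at_mult[OF linear_at_cmult[OF left[OF T]] left[OF T]])
  then have "bilinear_at p ?M"
    by (subst bilinear_at_cong[OF M]) (simp_all add: mult_ac)
  from metric_trace_eq[OF e this]
  have "metric_trace A g p ?M =
      (\<Sum>i\<in>UNIV. \<Sum>j\<in>UNIV. \<Sum>k\<in>UNIV. ?H (e i) (e j) * ?H (e i) (e k) * ?H (e j) (e k))"
    by (simp add: M T)
  then show ?thesis
    unfolding Q_op_def Let_def Q_frame_def
    by (simp add: laplacian_eq[OF e] tensor2_norm_eq[OF e bilinear_at_hessian])
qed

end


section \<open>Equivariance under isometries\<close>

context smooth_manifold
begin

lemma smooth_map_pullback:
  assumes \<phi>: "smooth_map A \<phi>" and f: "f \<in> smooth_functions A"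
  shows "f \<circ> \<phi> \<in> smooth_functions A"
proof (rule smooth_functionsI)
  fix U x assume c: "(U, x) \<in> A"
  show "smooth_on (x ` U) (f \<circ> \<phi> \<circ> inv_into U x)"
  proof (rule smooth_on_local)
    fix z assume "z \<in> x ` U"
    then obtain p where p: "p \<in> U" "z = x p" by blast
    obtain V y where c': "(V, y) \<in> A" "\<phi> p \<in> V" by (rule chart_exists)
    let ?T = "x ` (U \<inter> \<phi> -` V)"
    have "open (\<phi> -` V)"
      using \<phi> chart_open(1)[OF c'(1)] by (simp add: smooth_map_def continuous_on_open_vimage)
    then have T: "open ?T" by (rule chart_open_image[OF c])
    have "smooth_on ?T (\<lambda>z. (f \<circ> inv_into V y) ((y \<circ> \<phi> \<circ> inv_into U x) z))"
    proof (rule smooth_on_compose[OF T chart_open(2)[OF c'(1)] _ _ smooth_functions_rep[OF f c'(1)]])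
      show "(y \<circ> \<phi> \<circ> inv_into U x) ` ?T \<subseteq> y ` V" using c by auto
      show "smooth_on ?T (y \<circ> \<phi> \<circ> inv_into U x)"
        using \<phi> c c'(1) by (auto simp: smooth_map_def)
    qed
    then have "smooth_on ?T (f \<circ> \<phi> \<circ> inv_into U x)"
      by (rule smooth_on_cong[OF T]) (use c c' in auto)
    then show "\<exists>T. open T \<and> z \<in> T \<and> smooth_on T (f \<circ> \<phi> \<circ> inv_into U x)"
      using T p c'(2) by blast
  qed
qed

lemma diffeomorphism_inv:
  "diffeomorphism A \<phi> \<Longrightarrow> diffeomorphism A (inv \<phi>)"
  by (simp add: diffeomorphism_def bij_imp_bij_inv inv_inv_eq)

lemma diffeomorphism_apply:
  assumes "diffeomorphism A \<phi>"
  shows "inv \<phi> (\<phi> p) = p" "\<phi> (inv \<phi> p) = p"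
  using assms by (simp_all add: diffeomorphism_def bij_is_inj bij_is_surj surj_f_inv_f)

text \<open>Tangent vectors are zero on functions that are not smooth, so a push-forward is a tangent vector
  only because pulling back preserves non-smoothness too.\<close>

lemma diffeomorphism_pullback_iff:
  assumes "diffeomorphism A \<phi>"
  shows "f \<circ> \<phi> \<in> smooth_functions A \<longleftrightarrow> f \<in> smooth_functions A"
proof
  assume "f \<circ> \<phi> \<in> smooth_functions A"
  then have "f \<circ> \<phi> \<circ> inv \<phi> \<in> smooth_functions A"
    using smooth_map_pullback assms by (simp add: diffeomorphism_def)
  then show "f \<in> smooth_functions A"
    using diffeomorphism_apply(2)[OF assms] by (simp add: o_def)
qed (use smooth_map_pullback assms in \<open>simp add: diffeomorphism_def\<close>)

lemma push_forward_tangent: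
  assumes \<phi>: "diffeomorphism A \<phi>" and u: "u \<in> tangent_space A p"
  shows "push_forward \<phi> u \<in> tangent_space A (\<phi> p)"
proof -
  have sm: "smooth_map A \<phi>" using \<phi> by (simp add: diffeomorphism_def)
  obtain U x where c: "(U, x) \<in> A" "p \<in> U" by (rule chart_exists)
  obtain V y where c': "(V, y) \<in> A" "\<phi> p \<in> V" by (rule chart_exists)
  obtain a where a: "u = coord_vector A (U, x) p a" using u tangent_space_eq[OF c] by auto
  let ?T = "x ` (U \<inter> \<phi> -` V)"
  let ?\<Phi> = "y \<circ> \<phi> \<circ> inv_into U x"
  have "open (\<phi> -` V)"
    using sm chart_open(1)[OF c'(1)] by (simp add: smooth_map_def continuous_on_open_vimage)
  then have T: "open ?T" by (rule chart_open_image[OF c(1)])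
  have xp: "x p \<in> ?T" using c(2) c'(2) by blast
  have "smooth_on ?T ?\<Phi>" using sm c(1) c'(1) by (auto simp: smooth_map_def)
  then have d\<Phi>: "(?\<Phi> has_derivative frechet_derivative ?\<Phi> (at (x p))) (at (x p))"
    by (rule smooth_on_has_derivative[OF _ xp])
  have "push_forward \<phi> u f = coord_vector A (V, y) (\<phi> p) (frechet_derivative ?\<Phi> (at (x p)) a) f" for f
  proof (cases "f \<in> smooth_functions A")
    case True
    have "((f \<circ> inv_into V y) has_derivative (\<lambda>a. coord_vector A (V, y) (\<phi> p) a f)) (at (?\<Phi> (x p)))"
      using smooth_functions_has_derivative[OF True c'] c by simp
    from has_derivative_compose[OF d\<Phi> this]
    have "((f \<circ> \<phi> \<circ> inv_into U x) has_derivative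
        (\<lambda>a. coord_vector A (V, y) (\<phi> p) (frechet_derivative ?\<Phi> (at (x p)) a) f)) (at (x p))"
      by (rule has_derivative_transform_within_open[OF _ T xp]) (use c c' in auto)
    from has_derivative_unique[OF this
        smooth_functions_has_derivative[OF smooth_map_pullback[OF sm True] c]]
    have "coord_vector A (V, y) (\<phi> p) (frechet_derivative ?\<Phi> (at (x p)) a) f =
        coord_vector A (U, x) p a (f \<circ> \<phi>)" by (rule fun_cong)
    then show ?thesis by (simp add: push_forward_def a)
  next
    case False
    then show ?thesis
      using diffeomorphism_pullback_iff[OF \<phi>]
      by (simp add: push_forward_def a coord_vector_not_smooth)
  qed
  then have "push_forward \<phi> u =
      coord_vector A (V, y) (\<phi> p) (frechet_derivative ?\<Phi> (at (x p)) a)"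
    by (rule ext)
  then show ?thesis using tangent_coord[OF c'] by simp
qed

definition vf_push :: "('m \<Rightarrow> 'm) \<Rightarrow> 'm vector_field \<Rightarrow> 'm vector_field" where
  "vf_push \<phi> X = (\<lambda>q. push_forward \<phi> (X (inv \<phi> q)))"

lemma vf_push_in:
  assumes \<phi>: "diffeomorphism A \<phi>" and X: "X \<in> vector_fields A"
  shows "vf_push \<phi> X \<in> vector_fields A"
proof (rule vector_fieldI)
  fix q
  show "vf_push \<phi> X q \<in> tangent_space A q"
    using push_forward_tangent[OF \<phi> vector_field_tangent[OF X], of "inv \<phi> q"]
    by (simp add: vf_push_def diffeomorphism_apply(2)[OF \<phi>])
next
  fix f assume f: "f \<in> smooth_functions A"
  have "(\<lambda>p. X p (f \<circ> \<phi>)) \<circ> inv \<phi> \<in> smooth_functions A"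
    using \<phi> f by (intro smooth_map_pullback vector_field_smooth[OF X])
      (simp_all add: diffeomorphism_def)
  then show "(\<lambda>q. vf_push \<phi> X q f) \<in> smooth_functions A"
    by (simp add: vf_push_def push_forward_def o_def)
qed

lemma vf_push_apply:
  assumes "diffeomorphism A \<phi>"
  shows "vf_push \<phi> X (\<phi> p) = push_forward \<phi> (X p)"
    and "vf_push \<phi> X (\<phi> p) f = X p (f \<circ> \<phi>)"
  by (simp_all add: vf_push_def push_forward_def diffeomorphism_apply(1)[OF assms])

lemma push_forward_inv:
  assumes "diffeomorphism A \<phi>"
  shows "push_forward \<phi> (push_forward (inv \<phi>) u) = u"
  by (simp add: push_forward_def o_def diffeomorphism_apply(2)[OF assms])

end

context riemannian_levi_civita
begin

text \<open>The difference \<open>\<sigma>(X, Y, Z) = g (D'\<^sub>X Y - D\<^sub>X Y) Z\<close> of two torsion free metric connections is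
  symmetric in \<open>X, Y\<close> and skew in \<open>Y, Z\<close>. Alternating the two symmetries three times returns to the
  original order with the opposite sign.\<close>

lemma levi_civita_unique:
  assumes D': "\<And>X Y. X \<in> vector_fields A \<Longrightarrow> Y \<in> vector_fields A \<Longrightarrow> D' X Y \<in> vector_fields A"
    and torsion: "\<And>X Y. X \<in> vector_fields A \<Longrightarrow> Y \<in> vector_fields A \<Longrightarrow>
      (\<lambda>p f. D' X Y p f - D' Y X p f) = lie_bracket X Y"
    and compatible: "\<And>X Y Z p. X \<in> vector_fields A \<Longrightarrow> Y \<in> vector_fields A \<Longrightarrow>
      Z \<in> vector_fields A \<Longrightarrow>
      X p (\<lambda>q. g q (Y q) (Z q)) = g p (D' X Y p) (Z p) + g p (Y p) (D' X Z p)"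
    and X: "X \<in> vector_fields A" and Y: "Y \<in> vector_fields A"
  shows "D' X Y p = D X Y p"
proof -
  define d where "d = (\<lambda>X Y. \<lambda>f. 1 * D' X Y p f + (- 1) * D X Y p f)"
  have d_in: "d X Y \<in> tangent_space A p"
    if "X \<in> vector_fields A" "Y \<in> vector_fields A" for X Y
    unfolding d_def by (rule tangent_lincomb[OF vector_field_tangent[OF D'[OF that]]
          vector_field_tangent[OF connection_in[OF that]]])
  have sym: "d X Y = d Y X" if XY: "X \<in> vector_fields A" "Y \<in> vector_fields A" for X Y
  proof
    fix f
    have "(\<lambda>p f. D X Y p f - D Y X p f) = (\<lambda>p f. D' X Y p f - D' Y X p f)"
      using levi_civita XY by (simp add: levi_civita_def torsion)
    from fun_cong[OF fun_cong[OF this, of p], of f] show "d X Y f = d Y X f"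
      by (simp add: d_def)
  qed
  have skew: "g p (d X Y) (Z p) = - g p (d X Z) (Y p)"
    if XYZ: "X \<in> vector_fields A" "Y \<in> vector_fields A" "Z \<in> vector_fields A" for X Y Z
  proof -
    have split: "g p (d X Y) (Z p) = g p (D' X Y p) (Z p) - g p (D X Y p) (Z p)"
      if "X \<in> vector_fields A" "Y \<in> vector_fields A" "Z \<in> vector_fields A" for X Y Z
      using linear_atD[where s = 1 and t = "- 1",
          OF bilinear_at_left[OF bilinear_at_metric vector_field_tangent[OF that(3), of p]]
          vector_field_tangent[OF D'[OF that(1,2)], of p]
          vector_field_tangent[OF connection_in[OF that(1,2)], of p]]
      unfolding d_def by simp
    have "g p (D X Y p) (Z p) + g p (Y p) (D X Z p) = g p (D' X Y p) (Z p) + g p (Y p) (D' X Z p)"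
      using levi_civita compatible[OF XYZ, of p] XYZ by (simp add: levi_civita_def)
    then show ?thesis
      unfolding split[OF XYZ] split[OF XYZ(1,3,2)]
      using metric_commute[OF vector_field_tangent[OF XYZ(2)]
          vector_field_tangent[OF connection_in[OF XYZ(1,3)]], of p]
        metric_commute[OF vector_field_tangent[OF XYZ(2)]
          vector_field_tangent[OF D'[OF XYZ(1,3)]], of p]
      by simp
  qed
  obtain Z where Z: "Z \<in> vector_fields A" "Z p = d X Y"
    by (rule vector_field_extension[OF d_in[OF X Y]])
  have "g p (d X Y) (Z p) = - g p (d X Y) (Z p)"
    using skew[OF Y X Z(1)] skew[OF Z(1) Y X] skew[OF X Z(1) Y]
      sym[OF X Y] sym[OF Y Z(1)] sym[OF X Z(1)] by simp
  then have "g p (d X Y) (d X Y) = 0" by (simp add: Z(2))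
  then have "d X Y = (\<lambda>f. 0)" using metric_pos[OF d_in[OF X Y]] by force
  then show ?thesis by (simp add: d_def fun_eq_iff)
qed

lemma isometry_diffeomorphism: "isometry A g \<phi> \<Longrightarrow> diffeomorphism A \<phi>"
  by (simp add: isometry_def)

lemma isometry_metric:
  "isometry A g \<phi> \<Longrightarrow> u \<in> tangent_space A p \<Longrightarrow> v \<in> tangent_space A p \<Longrightarrow>
    g (\<phi> p) (push_forward \<phi> u) (push_forward \<phi> v) = g p u v"
  by (simp add: isometry_def)

text \<open>Pulling the connection back along an isometry gives another torsion free metric connection,
  which by uniqueness is the same connection.\<close>

lemma isometry_connection:
  assumes \<phi>: "isometry A g \<phi>" and X: "X \<in> vector_fields A" and Y: "Y \<in> vector_fields A"
  shows "D (vf_push \<phi> X) (vf_push \<phi> Y) (\<phi> p) = push_forward \<phi> (D X Y p)"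
proof -
  note diff = isometry_diffeomorphism[OF \<phi>]
  note diff' = diffeomorphism_inv[OF diff]
  note push_in = vf_push_in[OF diff]
  define D' where "D' = (\<lambda>X Y. vf_push (inv \<phi>) (D (vf_push \<phi> X) (vf_push \<phi> Y)))"
  have "inv (inv \<phi>) = \<phi>" using diff by (simp add: diffeomorphism_def inv_inv_eq)
  then have D'_apply: "D' X Y p = push_forward (inv \<phi>) (D (vf_push \<phi> X) (vf_push \<phi> Y) (\<phi> p))"
    for X Y p by (simp add: D'_def vf_push_def)
  then have D'_push: "push_forward \<phi> (D' X Y p) = D (vf_push \<phi> X) (vf_push \<phi> Y) (\<phi> p)" for X Y p
    by (simp add: push_forward_inv[OF diff])
  have D'_in: "D' X Y \<in> vector_fields A" if "X \<in> vector_fields A" "Y \<in> vector_fields A" for X Y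
    unfolding D'_def
    by (rule vf_push_in[OF diff' connection_in[OF push_in[OF that(1)] push_in[OF that(2)]]])
  have torsion: "(\<lambda>p f. D' X Y p f - D' Y X p f) = lie_bracket X Y"
    if XY: "X \<in> vector_fields A" "Y \<in> vector_fields A" for X Y
  proof (intro ext)
    fix p f
    have comp: "(\<lambda>q. vf_push \<phi> Z q (f \<circ> inv \<phi>)) \<circ> \<phi> = (\<lambda>q. Z q f)" for Z
      by (simp add: fun_eq_iff vf_push_apply(2)[OF diff])
        (simp add: o_def diffeomorphism_apply(1)[OF diff])
    have "(\<lambda>p f. D (vf_push \<phi> X) (vf_push \<phi> Y) p f - D (vf_push \<phi> Y) (vf_push \<phi> X) p f) =
        lie_bracket (vf_push \<phi> X) (vf_push \<phi> Y)"
      using levi_civita push_in XY by (simp add: levi_civita_def)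
    from fun_cong[OF fun_cong[OF this, of "\<phi> p"], of "f \<circ> inv \<phi>"]
    show "D' X Y p f - D' Y X p f = lie_bracket X Y p f"
      unfolding lie_bracket_def D'_apply push_forward_def vf_push_apply(2)[OF diff] comp .
  qed
  have compatible: "X p (\<lambda>q. g q (Y q) (Z q)) = g p (D' X Y p) (Z p) + g p (Y p) (D' X Z p)"
    if XYZ: "X \<in> vector_fields A" "Y \<in> vector_fields A" "Z \<in> vector_fields A" for X Y Z p
  proof -
    note tangent = vector_field_tangent
    have "(\<lambda>q. g q (vf_push \<phi> Y q) (vf_push \<phi> Z q)) \<circ> \<phi> = (\<lambda>q. g q (Y q) (Z q))"
      by (simp add: fun_eq_iff vf_push_apply(1)[OF diff]
          isometry_metric[OF \<phi> tangent[OF XYZ(2)] tangent[OF XYZ(3)]])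
    then have "X p (\<lambda>q. g q (Y q) (Z q)) =
        vf_push \<phi> X (\<phi> p) (\<lambda>q. g q (vf_push \<phi> Y q) (vf_push \<phi> Z q))"
      by (simp add: vf_push_apply(2)[OF diff])
    also have "\<dots> =
        g (\<phi> p) (D (vf_push \<phi> X) (vf_push \<phi> Y) (\<phi> p)) (vf_push \<phi> Z (\<phi> p)) +
        g (\<phi> p) (vf_push \<phi> Y (\<phi> p)) (D (vf_push \<phi> X) (vf_push \<phi> Z) (\<phi> p))"
      using levi_civita push_in XYZ by (simp add: levi_civita_def)
    also have "\<dots> = g p (D' X Y p) (Z p) + g p (Y p) (D' X Z p)"
      unfolding D'_push[symmetric] vf_push_apply(1)[OF diff]
      by (simp add: isometry_metric[OF \<phi> tangent[OF D'_in[OF XYZ(1,2)]] tangent[OF XYZ(3)]]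
          isometry_metric[OF \<phi> tangent[OF XYZ(2)] tangent[OF D'_in[OF XYZ(1,3)]]])
    finally show ?thesis .
  qed
  have "D' X Y p = D X Y p"
    by (rule levi_civita_unique[OF D'_in torsion compatible X Y])
  then show ?thesis using D'_push by metis
qed

text \<open>The Hessian is built from derivatives along vector fields and the connection, and pushing forward
  along an isometry is compatible with both.\<close>

lemma isometry_hessian:
  assumes \<phi>: "isometry A g \<phi>" and u: "u \<in> tangent_space A p" and v: "v \<in> tangent_space A p"
  shows "hessian A D f (\<phi> p) (push_forward \<phi> u) (push_forward \<phi> v) =
    hessian A D (f \<circ> \<phi>) p u v"
proof -
  note diff = isometry_diffeomorphism[OF \<phi>]
  obtain X where X: "X \<in> vector_fields A" "X p = u" by (rule vector_field_extension[OF u])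
  obtain Y where Y: "Y \<in> vector_fields A" "Y p = v" by (rule vector_field_extension[OF v])
  have "(\<lambda>q. vf_push \<phi> Y q f) \<circ> \<phi> = (\<lambda>q. Y q (f \<circ> \<phi>))"
    by (auto simp: vf_push_apply(2)[OF diff])
  then have "second_derivative (vf_push \<phi> X) (vf_push \<phi> Y) f (\<phi> p) =
      second_derivative X Y (f \<circ> \<phi>) p"
    by (simp add: second_derivative_def vf_push_apply(2)[OF diff]
        isometry_connection[OF \<phi> X(1) Y(1)] push_forward_def)
  then show ?thesis
    using hessian_vector_fields[OF vf_push_in[OF diff X(1)] vf_push_in[OF diff Y(1)], of f "\<phi> p"]
      hessian_vector_fields[OF X(1) Y(1), of "f \<circ> \<phi>" p]
    by (simp add: vf_push_apply(1)[OF diff] X(2) Y(2))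
qed

lemma isometry_orthonormal_basis:
  assumes \<phi>: "isometry A g \<phi>" and e: "orthonormal_basis A g p e"
  shows "orthonormal_basis A g (\<phi> p) (\<lambda>i. push_forward \<phi> (e i))"
  using push_forward_tangent[OF isometry_diffeomorphism[OF \<phi>]] isometry_metric[OF \<phi>] e
  by (simp add: orthonormal_basis_def)

text \<open>An isometry carries an orthonormal basis at \<open>p\<close> to one at \<open>\<phi> p\<close>, and the components of the
  gradient and the Hessian of \<open>f \<circ> \<phi>\<close> in the first are those of \<open>f\<close> in the second.\<close>

lemma isometry_equivariant:
  assumes \<phi>: "isometry A g \<phi>"
  shows "P_op A g D \<beta> (f \<circ> \<phi>) = P_op A g D \<beta> f \<circ> \<phi>"
    and "Q_op A g D \<beta> (f \<circ> \<phi>) = Q_op A g D \<beta> f \<circ> \<phi>"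
proof -
  have "P_op A g D \<beta> (f \<circ> \<phi>) p = P_op A g D \<beta> f (\<phi> p) \<and>
      Q_op A g D \<beta> (f \<circ> \<phi>) p = Q_op A g D \<beta> f (\<phi> p)" for p
  proof -
    obtain e where e: "orthonormal_basis A g p e" by (rule orthonormal_basis_exists)
    note e' = isometry_orthonormal_basis[OF \<phi> e]
    note H = isometry_hessian[OF \<phi> orthonormal_basisD(1)[OF e] orthonormal_basisD(1)[OF e]]
    show ?thesis
      unfolding P_op_frame[OF e] P_op_frame[OF e'] Q_op_frame[OF e] Q_op_frame[OF e'] H
      by (simp add: push_forward_def)
  qed
  then show "P_op A g D \<beta> (f \<circ> \<phi>) = P_op A g D \<beta> f \<circ> \<phi>"
    and "Q_op A g D \<beta> (f \<circ> \<phi>) = Q_op A g D \<beta> f \<circ> \<phi>"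
    by (auto simp: fun_eq_iff)
qed

end


section \<open>Dimension two and functions with a prescribed second-order jet\<close>

text \<open>Two eigenvalues have \<open>e\<^sub>3 = 0\<close>, and the single one that remains when one is omitted has
  \<open>e\<^sub>2 = 0\<close>. With only two indices this is a polynomial identity.\<close>

lemma frame_vanishes_dimension_2:
  fixes G :: "'n::finite \<Rightarrow> real" and H :: "'n \<Rightarrow> 'n \<Rightarrow> real"
  assumes "CARD('n) = 2" and sym: "\<And>i j. H i j = H j i"
  shows "P_frame G H = 0" "Q_frame H = 0"
proof -
  obtain a b :: 'n where ab: "UNIV = {a, b}" "a \<noteq> b"
    using assms(1) by (auto simp: card_2_iff)
  show "P_frame G H = 0" "Q_frame H = 0"
    unfolding P_frame_def Q_frame_def ab(1) using ab(2) sym[of b a]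
    by (simp_all add: power2_eq_square power3_eq_cube algebra_simps)
qed

text \<open>If all eigenvalues are \<open>1\<close> and \<open>G\<close> is a unit vector, the values are twice the binomial coefficient
  of \<open>d - 1\<close> over \<open>2\<close> and six times that of \<open>d\<close> over \<open>3\<close>.\<close>

lemma frame_identity_hessian:
  fixes k :: "'n::finite"
  defines "\<delta> \<equiv> \<lambda>i j :: 'n. if i = j then 1 else 0 :: real" and "d \<equiv> real CARD('n)"
  shows "P_frame (\<delta> k) \<delta> = (d - 1) * (d - 2)"
    and "Q_frame \<delta> = d * (d - 1) * (d - 2)"
proof -
  have [simp]: "(\<Sum>i\<in>UNIV. \<delta> k i * c i) = c k" "(\<Sum>i\<in>UNIV. \<delta> i k * c i) = c k" for k c
    by (simp_all add: \<delta>_def if_distrib[of "\<lambda>x. x * _"] cong: if_cong)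
  have [simp]: "(\<Sum>i\<in>UNIV. \<delta> k i) = 1" for k by (simp add: \<delta>_def)
  have [simp]: "(\<delta> i j)\<^sup>2 = \<delta> i j" "\<delta> i i = 1" for i j by (auto simp: \<delta>_def)
  have "(\<Sum>l\<in>UNIV. \<delta> i j * \<delta> i l * \<delta> j l) = \<delta> i j * \<delta> j i" for i j
    unfolding mult.assoc sum_distrib_left[symmetric] by simp
  then have "(\<Sum>i\<in>UNIV. \<Sum>j\<in>UNIV. \<Sum>l\<in>UNIV. \<delta> i j * \<delta> i l * \<delta> j l) = d"
    by (simp add: d_def)
  then show "Q_frame \<delta> = d * (d - 1) * (d - 2)"
    by (simp add: Q_frame_def d_def[symmetric] power2_eq_square power3_eq_cube algebra_simps)
  show "P_frame (\<delta> k) \<delta> = (d - 1) * (d - 2)"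
    by (simp add: P_frame_def d_def[symmetric] power2_eq_square algebra_simps)
qed

context riemannian_levi_civita
begin

lemma operators_vanish_dimension_2:
  assumes "CARD('n) = 2"
  shows "P_op A g D \<beta> f p = 0" "Q_op A g D \<beta> f p = 0"
proof -
  obtain e where e: "orthonormal_basis A g p e" by (rule orthonormal_basis_exists)
  note T = orthonormal_basisD(1)[OF e]
  show "P_op A g D \<beta> f p = 0" "Q_op A g D \<beta> f p = 0"
    unfolding P_op_frame[OF e] Q_op_frame[OF e]
    using frame_vanishes_dimension_2[OF assms, of "\<lambda>i j. hessian A D f p (e i) (e j)"]
      hessian_commute[OF T T] by simp_all
qed

text \<open>The covector \<open>u \<mapsto> g u w\<close> is \<open>b \<bullet> dx\<close> for a vector \<open>b\<close> of \<open>\<real>\<^sup>n\<close>, and it is the differential of the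
  corresponding cut-off coordinate.\<close>

lemma function_with_gradient:
  assumes w: "w \<in> tangent_space A p"
  obtains z where "z \<in> smooth_functions A" "z p = 0"
    "\<And>u. u \<in> tangent_space A p \<Longrightarrow> u z = g p u w"
proof -
  obtain U x where c: "(U, x) \<in> A" "p \<in> U" by (rule chart_exists)
  let ?t = "coord_vector A (U, x) p"
  obtain a where a: "w = ?t a" using w tangent_space_eq[OF c] by auto
  obtain \<psi> where \<psi>: "cutoff_chart (U, x) p \<psi>" by (rule cutoff_chart_exists[OF c])
  have lin: "linear (\<lambda>v. g p (?t v) (?t a))"
    using bilinear_coord[OF c] by (simp add: bilinear_def)
  define b where "b = adjoint (\<lambda>v. g p (?t v) (?t a)) 1"
  have b: "b \<bullet> v = g p (?t v) (?t a)" for v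
    using adjoint_works[OF lin, of v 1] by (simp add: b_def inner_commute)
  have "u (cutoff_coord (U, x) p \<psi> b) = g p u w" if "u \<in> tangent_space A p" for u
  proof -
    obtain v where v: "u = ?t v" using \<open>u \<in> tangent_space A p\<close> tangent_space_eq[OF c] by auto
    have "\<psi> (x p) = 1" using \<psi> by (simp add: cutoff_chart_def)
    then show ?thesis
      using coord_vector_cutoff_coord[OF \<psi> c(2), of v b] by (simp add: v a b)
  qed
  then show ?thesis
    by (rule that[OF cutoff_coord_smooth[OF \<psi>] cutoff_coord_center[OF \<psi>]])
qed

text \<open>Let \<open>z i\<close> vanish at \<open>p\<close> with differentials dual to the basis. The linear part
  \<open>l = \<Sum>i. G i z i\<close> prescribes the gradient but has some uncontrolled Hessian. A product \<open>z i z j\<close>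
  has vanishing gradient and a known Hessian, so such products correct that of \<open>l\<close>.\<close>

lemma prescribed_second_order_jet:
  assumes e: "orthonormal_basis A g p e" and H: "\<And>i j. H i j = (H j i :: real)"
  obtains f where "f \<in> smooth_functions A" "f p = r" "\<And>i. e i f = G i"
    "\<And>i j. hessian A D f p (e i) (e j) = H i j"
proof -
  note T = orthonormal_basisD(1)[OF e]
  have "\<exists>z. z \<in> smooth_functions A \<and> z p = 0 \<and> (\<forall>j. e j z = (if j = i then 1 else 0))" for i
  proof -
    obtain z where z: "z \<in> smooth_functions A" "z p = 0"
      "\<And>u. u \<in> tangent_space A p \<Longrightarrow> u z = g p u (e i)"
      by (rule function_with_gradient[OF T[of i]]) blast
    have "e j z = (if j = i then 1 else 0)" for j
      unfolding z(3)[OF T] by (rule orthonormal_basisD(2)[OF e])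
    then show ?thesis using z(1,2) by blast
  qed
  then obtain z where z: "\<And>i. z i \<in> smooth_functions A" "\<And>i. z i p = 0"
    "\<And>i j. e j (z i) = (if j = i then 1 else 0)" by metis
  define l where "l = (\<lambda>q. \<Sum>i\<in>UNIV. G i * z i q)"
  have l: "l \<in> smooth_functions A"
    unfolding l_def by (rule smooth_functions_sum, rule smooth_functions_scale, rule z)
  have el: "e j l = G j" for j
  proof -
    have "e j l = (\<Sum>i\<in>UNIV. e j (\<lambda>q. G i * z i q))"
      unfolding l_def by (rule tangent_fsum[OF T smooth_functions_scale[OF z(1)]])
    also have "\<dots> = (\<Sum>i\<in>UNIV. G i * (if j = i then 1 else 0))"
      by (simp only: tangent_cmult[OF T z(1)] z(3))
    finally show ?thesis by (simp add: if_distrib cong: if_cong)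
  qed
  define c where "c = (\<lambda>i j. (H i j - hessian A D l p (e i) (e j)) / 2)"
  have c_sym: "c i j = c j i" for i j
    using H[of i j] hessian_commute[OF T T, of l i j] by (simp add: c_def)
  define s where "s = (\<lambda>q. \<Sum>i\<in>UNIV. \<Sum>j\<in>UNIV. c i j * (z i q * z j q))"
  note zz = smooth_functions_mult[OF z(1) z(1)]
  note czz = smooth_functions_scale[OF zz]
  note sczz = smooth_functions_sum[OF czz]
  have s: "s \<in> smooth_functions A" unfolding s_def by (rule smooth_functions_sum[OF sczz])
  have es: "e a s = 0" for a
  proof -
    have "e a s = (\<Sum>i\<in>UNIV. \<Sum>j\<in>UNIV. c i j * e a (\<lambda>q. z i q * z j q))"
      unfolding s_def
      by (simp only: tangent_fsum[OF T sczz] tangent_fsum[OF T czz] tangent_cmult[OF T zz])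
    then show ?thesis by (simp add: tangent_mult[OF T z(1) z(1)] z(2))
  qed
  have hs: "hessian A D s p (e a) (e b) = 2 * c a b" for a b
  proof -
    have "hessian A D s p (e a) (e b) =
        (\<Sum>i\<in>UNIV. \<Sum>j\<in>UNIV. c i j * hessian A D (\<lambda>q. z i q * z j q) p (e a) (e b))"
      unfolding s_def
      by (simp only: hessian_sum[OF T T sczz] hessian_sum[OF T T czz] hessian_cmult[OF T T zz])
    also have "\<dots> = (\<Sum>i\<in>UNIV. \<Sum>j\<in>UNIV.
        (if i = a then if j = b then c i j else 0 else 0) +
        (if i = b then if j = a then c i j else 0 else 0))"
      by (intro sum.cong refl) (simp add: hessian_mult[OF T T z(1) z(1)] z(2,3))
    also have "\<dots> = c a b + c b a"
      by (simp add: sum.distrib sum.If_cases)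
    finally show ?thesis using c_sym[of a b] by simp
  qed
  have ls: "(\<lambda>q. l q + s q) \<in> smooth_functions A" by (rule smooth_functions_add[OF l s])
  show ?thesis
  proof (rule that)
    show "(\<lambda>q. r + (l q + s q)) \<in> smooth_functions A"
      by (rule smooth_functions_add[OF smooth_functions_const ls])
    show "r + (l p + s p) = r" by (simp add: l_def s_def z(2))
    show "e i (\<lambda>q. r + (l q + s q)) = G i" for i
      by (simp add: tangent_add[OF T smooth_functions_const ls] tangent_const[OF T]
          tangent_add[OF T l s] el es)
    show "hessian A D (\<lambda>q. r + (l q + s q)) p (e i) (e j) = H i j" for i j
      by (simp add: hessian_add[OF T T smooth_functions_const ls] hessian_const[OF T T]
          hessian_add[OF T T l s] hs c_def diff_divide_distrib)
  qed
qed

text \<open>A single 2-jet serves both operators and all exponents: the value \<open>1\<close> makes the factor \<open>f\<^sup>\<beta>\<close>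
  harmless, the gradient is a unit vector, and the Hessian is the metric.\<close>

lemma operators_nonzero:
  assumes "CARD('n) > 2"
  shows "\<exists>f\<in>smooth_functions A. \<exists>p. P_op A g D \<beta> f p \<noteq> 0 \<and> Q_op A g D \<beta> f p \<noteq> 0"
proof -
  fix p :: 'm and k :: 'n
  let ?\<delta> = "\<lambda>i j :: 'n. if i = j then 1 else 0 :: real"
  obtain e where e: "orthonormal_basis A g p e" by (rule orthonormal_basis_exists)
  obtain f where f: "f \<in> smooth_functions A" "f p = 1" "\<And>i. e i f = ?\<delta> k i"
    "\<And>i j. hessian A D f p (e i) (e j) = ?\<delta> i j"
    by (rule prescribed_second_order_jet[OF e, of ?\<delta> 1 "?\<delta> k"]) auto
  have "real CARD('n) > 2" using assms by simp
  then have "P_op A g D \<beta> f p \<noteq> 0" "Q_op A g D \<beta> f p \<noteq> 0"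
    unfolding P_op_frame[OF e] Q_op_frame[OF e] f(2-4) frame_identity_hessian by simp_all
  then show ?thesis using f(1) by blast
qed

end

theorem theorem1p2:
  fixes A :: "('m::{t2_space, second_countable_topology}, 'n::finite) chart set"
    and g :: "'m metric" and D :: "'m connection"
  assumes "riemannian_manifold A g" and "levi_civita A g D" and "CARD('n) \<ge> 2"
  shows "(\<forall>\<phi> f \<beta>. isometry A g \<phi> \<longrightarrow> f \<in> smooth_functions A \<longrightarrow>
            P_op A g D \<beta> (f \<circ> \<phi>) = P_op A g D \<beta> f \<circ> \<phi> \<and>
            Q_op A g D \<beta> (f \<circ> \<phi>) = Q_op A g D \<beta> f \<circ> \<phi>) \<and>
         (\<forall>\<beta>. ((\<forall>f\<in>smooth_functions A. \<forall>p. P_op A g D \<beta> f p = 0) \<longleftrightarrow> CARD('n) = 2) \<and>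
              ((\<forall>f\<in>smooth_functions A. \<forall>p. Q_op A g D \<beta> f p = 0) \<longleftrightarrow> CARD('n) = 2))"
proof -
  interpret riemannian_levi_civita A g D
    using assms(1,2) by unfold_locales
  have "CARD('n) = 2 \<or> CARD('n) > 2" using assms(3) by linarith
  then have "((\<forall>f\<in>smooth_functions A. \<forall>p. P_op A g D \<beta> f p = 0) \<longleftrightarrow> CARD('n) = 2) \<and>
      ((\<forall>f\<in>smooth_functions A. \<forall>p. Q_op A g D \<beta> f p = 0) \<longleftrightarrow> CARD('n) = 2)" for \<beta>
  proof
    assume "CARD('n) = 2"
    then show ?thesis using operators_vanish_dimension_2 by simp
  next
    assume "CARD('n) > 2"
    then show ?thesis using operators_nonzero[of \<beta>] by fastforce
  qed
  then show ?thesis using isometry_equivariant by blast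
qed

end
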